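(* Let $b$ be a prime, $m\in\mathbb{N}$, $N=b^m$, $s\in\mathbb{N}$, $\alpha>1$, let $(\gamma_{\mathfrak{u}})$ be positive weights, indexed by finite sets $\mathfrak{u}\subset\mathbb{N}$, with $\gamma_\emptyset=1$, let $0\le w_1\le w_2\le\cdots$ be integers, and put $Y_j=b^{w_j}$. Let $\boldsymbol{z}=(Y_1z_1,\ldots,Y_sz_s)$ be constructed by the reduced successive coordinate search (SCS) algorithm (defined in the context) from some initial vector $\boldsymbol{z}^0\in\{0,1,\ldots,N-1\}^s$. Then for all $\delta\in(0,\frac{\alpha-1}{2}]$, $$e_{N,s}(\boldsymbol{z})\le C_{s,\alpha,\boldsymbol{\gamma},\delta}\,N^{-\alpha/2+\delta},$$ where $$C_{s,\alpha,\boldsymbol{\gamma},\delta}:=\left(2\sum_{d=1}^s\ \sum_{d\in\mathfrak{u}\subseteq[s]}\gamma_{\mathfrak{u}}^{\frac{1}{\alpha-2\delta}}\left(2\zeta\left(\tfrac{\alpha}{\alpha-2\delta}\right)\right)^{|\mathfrak{u}|}b^{w_d}\right)^{\alpha/2-\delta}.$$ For $\delta\in(0,\frac{\alpha-1}{2}]$ and $q\ge0$ define $$C_{\delta,q}:=\sup_{s\in\mathbb{N}}\left[\frac{2}{s^q}\sum_{d=1}^s\ \sum_{d\in\mathfrak{u}\subseteq[s]}\gamma_{\mathfrak{u}}^{\frac{1}{\alpha-2\delta}}\left(2\zeta\left(\tfrac{\alpha}{\alpha-2\delta}\right)\right)^{|\mathfrak{u}|}b^{w_d}\right].$$ If $C_{\delta,q}<\infty$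 for some $\delta\in(0,\frac{\alpha-1}{2}]$ and $q\ge0$, then $$e_{N,s}(\boldsymbol{z})\le(s^qC_{\delta,q})^{\alpha/2-\delta}N^{-\alpha/2+\delta}.$$ If $C_{\delta,0}<\infty$ for some $\delta\in(0,\frac{\alpha-1}{2}]$, then $$e_{N,s}(\boldsymbol{z})\le(C_{\delta,0})^{\alpha/2-\delta}N^{-\alpha/2+\delta}.$$
   Context: Notation: $[s]=\{1,\ldots,s\}$, $\mathbb{Z}_*=\mathbb{Z}\setminus\{0\}$; for a vector $\boldsymbol{x}$ and $\mathfrak{u}\subseteq[s]$, $\boldsymbol{x}_{\mathfrak{u}}=(x_j)_{j\in\mathfrak{u}}$; $\{\cdot\}$ is the fractional part, applied componentwise; $\zeta$ is the Riemann zeta function. Weighted Korobov space: $\mathcal{H}(K_{s,\alpha,\boldsymbol{\gamma}})$ is the reproducing kernel Hilbert space of functions on $[0,1]^s$ with kernel $$K_{s,\alpha,\boldsymbol{\gamma}}(\boldsymbol{x},\boldsymbol{y})=1+\sum_{\emptyset\ne\mathfrak{u}\subseteq[s]}\gamma_{\mathfrak{u}}\sum_{\boldsymbol{h}_{\mathfrak{u}}\in\mathbb{Z}_*^{|\mathfrak{u}|}}\frac{\exp(2\pi \mathrm{i}\,\boldsymbol{h}_{\mathfrak{u}}\cdot(\boldsymbol{x}_{\mathfrak{u}}-\boldsymbol{y}_{\mathfrak{u}}))}{\prod_{j\in\mathfrak{u}}|h_j|^\alpha}.$$ Worst-case error: for $\boldsymbol{\xi}\in\mathbb{Z}^s$,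 $e_{N,s}(\boldsymbol{\xi})$ is the supremum of $\left|\int_{[0,1]^s}f(\boldsymbol{x})\,\mathrm{d}\boldsymbol{x}-\frac1N\sum_{n=0}^{N-1}f(\{n\boldsymbol{\xi}/N\})\right|$ over all $f$ in the unit ball of $\mathcal{H}(K_{s,\alpha,\boldsymbol{\gamma}})$. It is known that $$e_{N,s}^2(\boldsymbol{\xi})=\sum_{\emptyset\ne\mathfrak{u}\subseteq[s]}\gamma_{\mathfrak{u}}\sum_{\boldsymbol{h}_{\mathfrak{u}}\in\mathcal{D}_{\mathfrak{u}}(\boldsymbol{\xi}_{\mathfrak{u}})}\ \prod_{j\in\mathfrak{u}}|h_j|^{-\alpha},\qquad \mathcal{D}_{\mathfrak{u}}(\boldsymbol{\xi}_{\mathfrak{u}})=\{\boldsymbol{h}_{\mathfrak{u}}\in\mathbb{Z}_*^{|\mathfrak{u}|}:\boldsymbol{h}_{\mathfrak{u}}\cdot\boldsymbol{\xi}_{\mathfrak{u}}\equiv0\ (\mathrm{mod}\ N)\}.$$ Search spaces: $\mathcal{Z}_{N,w_j}=\{z\in\{1,2,\ldots,b^{m-w_j}-1\}:\gcd(z,N)=1\}$ if $w_j<m$, and $\mathcal{Z}_{N,w_j}=\{1\}$ if $w_j\ge m$. Reduced SCS algorithm: given $\boldsymbol{z}^0=(z_1^0,\ldots,z_s^0)$, for $d=1,2,\ldots,s$ successively, with $z_1,\ldots,z_{d-1}$ already selected, choose $z_d\in\mathcal{Z}_{N,w_d}$ such that $e_{N,s}^2((Y_1z_1,\ldots,Y_{d-1}z_{d-1},Y_dz_d,z_{d+1}^0,\ldots,z_s^0))$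 is minimized as a function of $z_d$ over $\mathcal{Z}_{N,w_d}$. The output is $\boldsymbol{z}=(Y_1z_1,\ldots,Y_sz_s)$. *)

theory Defs
  imports "HOL-Analysis.Analysis" "HOL-Computational_Algebra.Primes"
begin

definition ip_norm :: "(('a \<Rightarrow> complex) \<Rightarrow> ('a \<Rightarrow> complex) \<Rightarrow> complex) \<Rightarrow> ('a \<Rightarrow> complex) \<Rightarrow> real"
  where "ip_norm ip f = sqrt (Re (ip f f))"

text \<open>
  A function on \<open>X\<close> is represented by the total function that extends it by zero outside \<open>X\<close>, so
  that the pointwise operations on total functions are those on functions on \<open>X\<close>.
\<close>

definition kernel_section :: "'a set \<Rightarrow> ('a \<Rightarrow> 'a \<Rightarrow> complex) \<Rightarrow> 'a \<Rightarrow> 'a \<Rightarrow> complex"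
  where "kernel_section X K y = (\<lambda>x. if x \<in> X then K x y else 0)"

text \<open>
  By the Moore-Aronszajn theorem, a positive semidefinite kernel \<open>K\<close> determines \<open>H\<close> uniquely,
  and \<open>ip\<close> uniquely on \<open>H\<close>.
\<close>

locale rkhs =
  fixes X :: "'a set"
    and K :: "'a \<Rightarrow> 'a \<Rightarrow> complex"
    and H :: "('a \<Rightarrow> complex) set"
    and ip :: "('a \<Rightarrow> complex) \<Rightarrow> ('a \<Rightarrow> complex) \<Rightarrow> complex"
  assumes vanish_outside: "\<And>f x. f \<in> H \<Longrightarrow> x \<notin> X \<Longrightarrow> f x = 0"
    and zero_mem: "(\<lambda>x. 0) \<in> H"
    and add_mem: "\<And>f g. f \<in> H \<Longrightarrow> g \<in> H \<Longrightarrow> (\<lambda>x. f x + g x) \<in> H"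
    and scale_mem: "\<And>c f. f \<in> H \<Longrightarrow> (\<lambda>x. c * f x) \<in> H"
    and ip_add: "\<And>f g h. f \<in> H \<Longrightarrow> g \<in> H \<Longrightarrow> h \<in> H \<Longrightarrow>
      ip (\<lambda>x. f x + g x) h = ip f h + ip g h"
    and ip_scale: "\<And>c f g. f \<in> H \<Longrightarrow> g \<in> H \<Longrightarrow> ip (\<lambda>x. c * f x) g = c * ip f g"
    and ip_commute: "\<And>f g. f \<in> H \<Longrightarrow> g \<in> H \<Longrightarrow> ip g f = cnj (ip f g)"
    and ip_pos: "\<And>f. f \<in> H \<Longrightarrow> f \<noteq> (\<lambda>x. 0) \<Longrightarrow> 0 < Re (ip f f)"
    and complete: "Metric_space.mcomplete H (\<lambda>f g. ip_norm ip (\<lambda>x. f x - g x))"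
    and section_mem: "\<And>y. y \<in> X \<Longrightarrow> kernel_section X K y \<in> H"
    and reproducing: "\<And>f y. f \<in> H \<Longrightarrow> y \<in> X \<Longrightarrow> f y = ip f (kernel_section X K y)"

definition unit_cube :: "nat \<Rightarrow> (nat \<Rightarrow> real) set"
  where "unit_cube s = (\<Pi>\<^sub>E j\<in>{1..s}. {0..1})"

definition cube_measure :: "nat \<Rightarrow> (nat \<Rightarrow> real) measure"
  where "cube_measure s = (\<Pi>\<^sub>M j\<in>{1..s}. restrict_space lborel {0..1})"

definition korobov_kernel ::
    "nat \<Rightarrow> real \<Rightarrow> (nat set \<Rightarrow> real) \<Rightarrow> (nat \<Rightarrow> real) \<Rightarrow> (nat \<Rightarrow> real) \<Rightarrow> complex"
  where "korobov_kernel s \<alpha> \<gamma> x y =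
    1 + (\<Sum>u\<in>Pow {1..s} - {{}}. of_real (\<gamma> u) *
          (\<Sum>\<^sub>\<infinity>h\<in>(\<Pi>\<^sub>E j\<in>u. - {0 :: int}).
             exp (2 * of_real pi * \<i> * of_real (\<Sum>j\<in>u. real_of_int (h j) * (x j - y j)))
               / of_real (\<Prod>j\<in>u. \<bar>real_of_int (h j)\<bar> powr \<alpha>)))"

definition lattice_point :: "nat \<Rightarrow> nat \<Rightarrow> (nat \<Rightarrow> int) \<Rightarrow> nat \<Rightarrow> nat \<Rightarrow> real"
  where "lattice_point N s \<xi> n = (\<lambda>j\<in>{1..s}. frac (real n * real_of_int (\<xi> j) / real N))"

definition worst_case_error ::
    "((nat \<Rightarrow> real) \<Rightarrow> complex) set
     \<Rightarrow> (((nat \<Rightarrow> real) \<Rightarrow> complex) \<Rightarrow> ((nat \<Rightarrow> real) \<Rightarrow> complex) \<Rightarrow> complex)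
     \<Rightarrow> nat \<Rightarrow> nat \<Rightarrow> (nat \<Rightarrow> int) \<Rightarrow> real"
  where "worst_case_error H ip N s \<xi> =
    (SUP f\<in>{f \<in> H. ip_norm ip f \<le> 1}.
       cmod ((\<integral>x. f x \<partial>cube_measure s)
             - (1 / of_nat N) * (\<Sum>n<N. f (lattice_point N s \<xi> n))))"

definition search_space :: "nat \<Rightarrow> nat \<Rightarrow> nat \<Rightarrow> int set"
  where "search_space b m k =
    (if k < m then {z \<in> {1..int b ^ (m - k) - 1}. gcd z (int (b ^ m)) = 1} else {1})"

text \<open>
  The minimiser in a step of the search need not be unique, so the algorithm is a relation:
  \<open>reduced_scs e2 b m s w z0 z\<close> holds iff \<open>z 1, \<dots>, z s\<close> is a possible sequence of choices of
  the search with objective function \<open>e2\<close>. The constructed vector is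
  \<open>\<lambda>j. int b ^ w j * z j\<close>.
\<close>

definition reduced_scs ::
    "((nat \<Rightarrow> int) \<Rightarrow> real) \<Rightarrow> nat \<Rightarrow> nat \<Rightarrow> nat \<Rightarrow> (nat \<Rightarrow> nat) \<Rightarrow> (nat \<Rightarrow> int) \<Rightarrow> (nat \<Rightarrow> int) \<Rightarrow> bool"
  where "reduced_scs e2 b m s w z0 z \<longleftrightarrow>
    (\<forall>d\<in>{1..s}.
       is_arg_min
         (\<lambda>\<zeta>. e2 (\<lambda>j. if j < d then int b ^ w j * z j
                      else if j = d then int b ^ w d * \<zeta>
                      else z0 j))
         (\<lambda>\<zeta>. \<zeta> \<in> search_space b m (w d))
         (z d))"

text \<open>The Riemann zeta function, for real arguments greater than 1.\<close>

definition real_zeta :: "real \<Rightarrow> real"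
  where "real_zeta t = (\<Sum>n. 1 / real (Suc n) powr t)"

definition weight_sum ::
    "nat \<Rightarrow> (nat \<Rightarrow> nat) \<Rightarrow> real \<Rightarrow> (nat set \<Rightarrow> real) \<Rightarrow> real \<Rightarrow> nat \<Rightarrow> real"
  where "weight_sum b w \<alpha> \<gamma> \<delta> s =
    (\<Sum>d=1..s. \<Sum>u\<in>{u. d \<in> u \<and> u \<subseteq> {1..s}}.
       \<gamma> u powr (1 / (\<alpha> - 2 * \<delta>)) * (2 * real_zeta (\<alpha> / (\<alpha> - 2 * \<delta>))) ^ card u * real b ^ w d)"

definition const_C ::
    "nat \<Rightarrow> (nat \<Rightarrow> nat) \<Rightarrow> nat \<Rightarrow> real \<Rightarrow> (nat set \<Rightarrow> real) \<Rightarrow> real \<Rightarrow> real"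
  where "const_C b w s \<alpha> \<gamma> \<delta> = (2 * weight_sum b w \<alpha> \<gamma> \<delta> s) powr (\<alpha> / 2 - \<delta>)"

definition const_C_sup ::
    "nat \<Rightarrow> (nat \<Rightarrow> nat) \<Rightarrow> real \<Rightarrow> (nat set \<Rightarrow> real) \<Rightarrow> real \<Rightarrow> real \<Rightarrow> ereal"
  where "const_C_sup b w \<alpha> \<gamma> \<delta> q =
    (SUP s\<in>{1..}. ereal (2 / real s powr q * weight_sum b w \<alpha> \<gamma> \<delta> s))"

end

theory Submission
  imports Defs "HOL-Number_Theory.Totient" "HOL-Probability.Probability_Measure"
begin

text \<open>
  The integral over the cube is a limit of averages over the grids \<open>{0, 1/M, ..., (M-1)/M}^s\<close>, so the
  error functional on the Korobov space is the limit of the functionals represented by differences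
  of averaged kernel sections. Cauchy-Schwarz and these differences as test functions give
  \<open>e^2 = \<Sum>u. \<gamma> u * dual_sum \<alpha> N u \<xi>\<close>, a sum over the dual lattice.

  Put \<open>l = 1 / (\<alpha> - 2\<delta>)\<close>. In step \<open>d\<close> only the sets \<open>u\<close> containing \<open>d\<close> matter. Their contribution at
  the minimiser, raised to the power \<open>l \<le> 1\<close>, is at most its mean over the search space; by
  subadditivity of \<open>t powr l\<close> the power can be moved onto the individual frequencies, and counting
  solutions of linear congruences bounds the mean. Finally a set \<open>u\<close> with maximum \<open>d\<close> is unaffected by
  the steps after \<open>d\<close>, so the error of the output is at most the sum of the \<open>d\<close>-th contributions at
  the \<open>d\<close>-th minimisers.
\<close>

section \<open>Zeta sums and exponential sums\<close>

text \<open>The integral is represented by the constant function 1, but its membership in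
  \<open>H\<close> is not immediate from the axioms of \<open>rkhs\<close>. Averaged kernel sections
  lie in \<open>H\<close> for every finite family of nodes, and their inner products are averages of
  kernel values. Averaging over a grid with M points per axis cancels all frequencies that are not
  multiples of M, so the grid sections tend to 1 uniformly on the cube; this suffices for every
  limit needed.

  The exponent l balances two demands. A mean over the search space gives only the rate 1/N, which
  the power 1/l turns into the exponent \<alpha> - 2\<delta> for e^2. In exchange the frequency sums
  carry the exponent \<alpha> * l, and \<delta> > 0 keeps it above 1.

  In step \<open>d\<close> the later coordinates hold initial values and the earlier ones previous
  choices. The mean must therefore be bounded uniformly in all other coordinates, which leads to
  inhomogeneous congruences. The factor 2 in the constant comes from the totient of b^n being at
  least b^n / 2.\<close>

lemma has_sum_nonzero_int_powr:
  assumes "1 < a"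
  shows "((\<lambda>h::int. 1 / \<bar>real_of_int h\<bar> powr a) has_sum 2 * real_zeta a) (- {0})"
proof -
  have "summable (\<lambda>n. real n powr - a)"
    using assms by (simp add: summable_real_powr_iff)
  then have "summable (\<lambda>n. 1 / real (Suc n) powr a)"
    by (subst (asm) summable_Suc_iff[symmetric]) (simp add: powr_minus field_simps)
  then have nat: "((\<lambda>n. 1 / real (Suc n) powr a) has_sum real_zeta a) UNIV"
    unfolding real_zeta_def by (intro sums_nonneg_imp_has_sum summable_sums) auto
  have "((\<lambda>h::int. 1 / \<bar>real_of_int h\<bar> powr a) has_sum real_zeta a) {1..}"
    using nat by (rule has_sum_reindex_bij_witness[of _ "\<lambda>h. nat (h - 1)" "\<lambda>n. int (Suc n)", THEN iffD1, rotated -1])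
      (auto simp: add.commute)
  moreover have "((\<lambda>h::int. 1 / \<bar>real_of_int h\<bar> powr a) has_sum real_zeta a) {..-1}"
    using nat by (rule has_sum_reindex_bij_witness[of _ "\<lambda>h. nat (- h - 1)" "\<lambda>n. - int (Suc n)", THEN iffD1, rotated -1])
      (auto simp: add.commute)
  ultimately have "((\<lambda>h::int. 1 / \<bar>real_of_int h\<bar> powr a) has_sum (real_zeta a + real_zeta a)) ({1..} \<union> {..-1})"
    by (intro has_sum_Un_disjoint) auto
  moreover have "{1..} \<union> {..-1} = - {0::int}" by auto
  ultimately show ?thesis by simp
qed

text \<open>Substituting h = g * h' pulls out the factor \<open>g powr - a\<close>. Such sums arise
  wherever only frequencies divisible by some modulus survive, on grids as well as in linear
  congruences.\<close>

lemma has_sum_multiples_powr: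
  assumes "1 < a" "0 < g"
  shows "((\<lambda>h::int. 1 / \<bar>real_of_int h\<bar> powr a) has_sum 2 * real_zeta a / real g powr a)
           {h. h \<noteq> 0 \<and> int g dvd h}"
proof -
  have "((\<lambda>h::int. 1 / \<bar>real_of_int (int g * h)\<bar> powr a) has_sum 2 * real_zeta a / real g powr a) (- {0})"
    using has_sum_divide_const[OF has_sum_nonzero_int_powr[OF assms(1)], of "real g powr a"]
    by (simp add: abs_mult powr_mult mult.commute)
  then show ?thesis
    by (rule has_sum_reindex_bij_witness[of _ "\<lambda>h. h div int g" "\<lambda>h. int g * h", THEN iffD1, rotated -1])
      (use assms in auto)
qed

lemma real_zeta_pos:
  assumes "1 < a"
  shows "0 < real_zeta a"
proof -
  have "sum (\<lambda>h::int. 1 / \<bar>real_of_int h\<bar> powr a) {1} \<le> 2 * real_zeta a"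
    by (rule finite_sum_le_has_sum[OF has_sum_nonzero_int_powr[OF assms]]) auto
  then show ?thesis by simp
qed

text \<open>Orthogonality of characters modulo \<open>N\<close>: the terms are the powers of an
  \<open>N\<close>-th root of unity, whose geometric sum vanishes unless the root is 1.\<close>

lemma sum_exp_residues:
  assumes "0 < N"
  shows "(\<Sum>n<N. exp (2 * of_real pi * \<i> * of_real (real n * real_of_int c / real N)))
           = (if int N dvd c then of_nat N else 0)"
proof -
  define \<omega> where "\<omega> = exp (2 * of_real pi * \<i> * of_real (real_of_int c / real N))"
  have pw: "exp (2 * of_real pi * \<i> * of_real (real n * real_of_int c / real N)) = \<omega> ^ n" for n
    unfolding \<omega>_def exp_of_nat_mult[symmetric] by (simp add: algebra_simps)
  have \<omega>N: "\<omega> ^ N = 1"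
    unfolding pw[symmetric] using assms by (simp add: exp_eq_1) 
  have \<omega>1: "\<omega> = 1 \<longleftrightarrow> int N dvd c"
  proof
    assume "\<omega> = 1"
    then obtain n :: int where "2 * pi * (real_of_int c / real N) = of_int (2 * n) * pi"
      unfolding \<omega>_def exp_eq_1 by auto
    then have "real_of_int c = real_of_int (n * int N)"
      using assms by (simp add: field_simps)
    then have "c = n * int N" using of_int_eq_iff by blast
    then show "int N dvd c" by simp
  next
    assume "int N dvd c"
    then obtain k where "c = int N * k" by auto
    then show "\<omega> = 1" using assms unfolding \<omega>_def exp_eq_1 by auto
  qed
  show ?thesis
    unfolding pw using \<omega>1 \<omega>N by (auto simp: sum_gp_strict)
qed

section \<open>Absolutely convergent sums over frequency vectors\<close>

lemma has_sum_sum: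
  fixes f :: "'i \<Rightarrow> 'a \<Rightarrow> 'b :: topological_comm_monoid_add"
  assumes "\<And>i. i \<in> I \<Longrightarrow> (f i has_sum s i) A"
  shows "((\<lambda>x. \<Sum>i\<in>I. f i x) has_sum (\<Sum>i\<in>I. s i)) A"
  using assms by (induction I rule: infinite_finite_induct) (auto intro: has_sum_add)

text \<open>A finite set of functions is contained in the finite box spanned by its coordinate
  projections. Over that box the sum of products factors, so the product of the full sums bounds all
  partial sums.\<close>

lemma summable_on_prod_PiE_nonneg:
  fixes f :: "'a \<Rightarrow> 'b \<Rightarrow> real"
  assumes "finite A" "\<And>x. x \<in> A \<Longrightarrow> f x summable_on B x"
    and "\<And>x y. x \<in> A \<Longrightarrow> y \<in> B x \<Longrightarrow> 0 \<le> f x y"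
  shows "(\<lambda>g. \<Prod>x\<in>A. f x (g x)) summable_on PiE A B"
proof (rule nonneg_bounded_partial_sums_imp_summable_on)
  show "\<forall>\<^sub>F P in finite_subsets_at_top (PiE A B).
          (\<Sum>g\<in>P. \<Prod>x\<in>A. f x (g x)) \<le> (\<Prod>x\<in>A. infsum (f x) (B x))"
  proof (rule eventually_finite_subsets_at_top_weakI)
    fix P assume P: "finite P" "P \<subseteq> PiE A B"
    define B' where "B' x = (\<lambda>g. g x) ` P" for x
    have B': "finite (B' x)" "x \<in> A \<Longrightarrow> B' x \<subseteq> B x" for x
      using P by (auto simp: B'_def)
    have "(\<Sum>g\<in>P. \<Prod>x\<in>A. f x (g x)) \<le> (\<Sum>g\<in>PiE A B'. \<Prod>x\<in>A. f x (g x))"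
    proof (rule sum_mono2)
      show "finite (PiE A B')" using B' assms(1) by (intro finite_PiE) auto
      show "P \<subseteq> PiE A B'" using P by (auto simp: B'_def)
      show "0 \<le> (\<Prod>x\<in>A. f x (g x))" if "g \<in> PiE A B' - P" for g
        using that B'(2) assms(3) by (intro prod_nonneg) blast
    qed
    also have "\<dots> = (\<Prod>x\<in>A. \<Sum>y\<in>B' x. f x y)"
      using assms(1) B'(1) by (simp add: prod_sum_PiE)
    also have "\<dots> \<le> (\<Prod>x\<in>A. infsum (f x) (B x))"
      using B' assms by (intro prod_mono conjI sum_nonneg finite_sum_le_infsum) blast+
    finally show "(\<Sum>g\<in>P. \<Prod>x\<in>A. f x (g x)) \<le> (\<Prod>x\<in>A. infsum (f x) (B x))" .
  qed
qed (use assms in \<open>auto intro!: prod_nonneg\<close>)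

definition freqs :: "nat set \<Rightarrow> (nat \<Rightarrow> int) set"
  where "freqs u = (\<Pi>\<^sub>E j\<in>u. - {0})"

definition freq_weight :: "real \<Rightarrow> nat set \<Rightarrow> (nat \<Rightarrow> int) \<Rightarrow> real"
  where "freq_weight a u h = (\<Prod>j\<in>u. 1 / \<bar>real_of_int (h j)\<bar> powr a)"

lemma freq_weight_nonneg: "0 \<le> freq_weight a u h"
  by (simp add: freq_weight_def prod_nonneg)

lemma freq_weight_powr: "freq_weight a u h powr l = freq_weight (a * l) u h"
  unfolding freq_weight_def by (subst prod_powr_distrib) (auto simp: powr_divide powr_powr)

lemma has_sum_freq_weight:
  assumes "1 < a" "finite u"
  shows "(freq_weight a u has_sum (2 * real_zeta a) ^ card u) (freqs u)"
proof -
  note hs = has_sum_nonzero_int_powr[OF assms(1)]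
  have "freq_weight a u summable_on freqs u"
    unfolding freq_weight_def freqs_def using hs has_sum_imp_summable assms(2)
    by (intro summable_on_prod_PiE_nonneg) auto
  moreover have "infsum (freq_weight a u) (freqs u) = (2 * real_zeta a) ^ card u"
    unfolding freq_weight_def freqs_def
    by (subst infsum_prod_PiE_abs) (use assms hs in \<open>auto simp: infsumI dest: has_sum_imp_summable\<close>)
  ultimately show ?thesis by (simp add: has_sum_iff)
qed

section \<open>Subadditivity of powers with exponent at most 1\<close>

text \<open>After scaling to x + y = 1 both terms lie in [0,1], where t \<le>
  \<open>t powr l\<close>.\<close>

lemma powr_add_le_add_powr:
  fixes x y l :: real
  assumes "0 \<le> x" "0 \<le> y" "0 < l" "l \<le> 1"
  shows "(x + y) powr l \<le> x powr l + y powr l"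
proof (cases "x + y = 0")
  case False
  then have s: "0 < x + y" using assms by linarith
  have le: "t \<le> t powr l" if "0 \<le> t" "t \<le> 1" for t :: real
    using that assms powr_mono'[of l 1 t] by (cases "t = 0") auto
  have "1 = x / (x + y) + y / (x + y)" using s by (simp flip: add_divide_distrib)
  also have "\<dots> \<le> (x / (x + y)) powr l + (y / (x + y)) powr l"
    using assms s by (intro add_mono le) auto
  also have "\<dots> = (x powr l + y powr l) / (x + y) powr l"
    using assms s by (simp add: powr_divide add_divide_distrib)
  finally show ?thesis using s by (simp add: field_simps)
qed (use assms in auto)

lemma sum_powr_le_sum_of_powr:
  fixes f :: "'a \<Rightarrow> real"
  assumes "\<And>x. x \<in> A \<Longrightarrow> 0 \<le> f x" "0 < l" "l \<le> 1"
  shows "(sum f A) powr l \<le> (\<Sum>x\<in>A. f x powr l)"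
  using assms(1)
proof (induction A rule: infinite_finite_induct)
  case (insert x A)
  then have "(sum f (insert x A)) powr l \<le> f x powr l + (sum f A) powr l"
    using assms(2,3) by (auto intro!: powr_add_le_add_powr sum_nonneg)
  also have "\<dots> \<le> f x powr l + (\<Sum>x\<in>A. f x powr l)" using insert by auto
  finally show ?case using insert by simp
qed (use assms in auto)

text \<open>The infinite sum is the supremum of its finite partial sums, so the finite inequality is
  first rewritten as an upper bound on the partial sums themselves by taking the power 1/l. The
  power l is restored afterwards.\<close>

lemma infsum_powr_le:
  fixes f :: "'a \<Rightarrow> real"
  assumes "f summable_on A" "(\<lambda>x. f x powr l) summable_on A"
    and "\<And>x. x \<in> A \<Longrightarrow> 0 \<le> f x" "0 < l" "l \<le> 1"
  shows "(infsum f A) powr l \<le> infsum (\<lambda>x. f x powr l) A"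
proof -
  have "infsum f A \<le> infsum (\<lambda>x. f x powr l) A powr (1 / l)"
  proof (rule infsum_le_finite_sums[OF assms(1)])
    fix F assume F: "finite F" "F \<subseteq> A"
    have "(sum f F) powr l \<le> (\<Sum>x\<in>F. f x powr l)"
      using F assms by (intro sum_powr_le_sum_of_powr) auto
    also have "\<dots> \<le> infsum (\<lambda>x. f x powr l) A"
      using F assms(2) by (intro finite_sum_le_infsum) auto
    finally have "((sum f F) powr l) powr (1 / l) \<le> infsum (\<lambda>x. f x powr l) A powr (1 / l)"
      using assms by (intro powr_mono2) auto
    moreover have "0 \<le> sum f F" using F assms by (intro sum_nonneg) auto
    ultimately show "sum f F \<le> infsum (\<lambda>x. f x powr l) A powr (1 / l)"
      using assms by (simp add: powr_powr)
  qed
  then have "(infsum f A) powr l \<le> (infsum (\<lambda>x. f x powr l) A powr (1 / l)) powr l"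
    using assms by (intro powr_mono2 infsum_nonneg) auto
  also have "\<dots> = infsum (\<lambda>x. f x powr l) A"
    using assms by (simp add: powr_powr infsum_nonneg)
  finally show ?thesis .
qed

section \<open>Reproducing kernel Hilbert spaces\<close>

context rkhs
begin

lemma diff_mem: "f \<in> H \<Longrightarrow> g \<in> H \<Longrightarrow> (\<lambda>x. f x - g x) \<in> H"
  using add_mem[OF _ scale_mem[of g "- 1"], of f] by simp

lemma ip_diff_left: "f \<in> H \<Longrightarrow> g \<in> H \<Longrightarrow> h \<in> H \<Longrightarrow> ip (\<lambda>x. f x - g x) h = ip f h - ip g h"
  using ip_add[OF _ scale_mem[of g "- 1"], of f h] ip_scale[of g h "- 1"] by simp

lemma ip_diff_right:
  assumes "f \<in> H" "g \<in> H" "h \<in> H"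
  shows "ip h (\<lambda>x. f x - g x) = ip h f - ip h g"
  using assms ip_diff_left[of f g h] ip_commute[of "\<lambda>x. f x - g x" h] ip_commute[of f h] ip_commute[of g h]
  by (simp add: diff_mem)

lemma ip_zero_left: "f \<in> H \<Longrightarrow> ip (\<lambda>x. 0) f = 0"
  using ip_scale[of f f 0] by simp

lemma ip_zero_right: "f \<in> H \<Longrightarrow> ip f (\<lambda>x. 0) = 0"
  using ip_commute[of "\<lambda>x. 0" f] ip_zero_left[of f] zero_mem by simp

lemma ip_scale_right: "f \<in> H \<Longrightarrow> g \<in> H \<Longrightarrow> ip f (\<lambda>x. c * g x) = cnj c * ip f g"
  using ip_commute[of "\<lambda>x. c * g x" f] ip_commute[of g f] ip_scale[of g f c] scale_mem by simp

lemma lincomb_mem: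
  assumes "\<And>i. i \<in> I \<Longrightarrow> g i \<in> H"
  shows "(\<lambda>x. \<Sum>i\<in>I. c i * g i x) \<in> H"
  using assms
proof (induction I rule: infinite_finite_induct)
  case (insert j I)
  then show ?case using add_mem[OF scale_mem[of "g j" "c j"], of "\<lambda>x. \<Sum>i\<in>I. c i * g i x"] by simp
qed (auto intro: zero_mem)

lemma ip_lincomb_right:
  assumes "\<And>i. i \<in> I \<Longrightarrow> g i \<in> H" "f \<in> H"
  shows "ip f (\<lambda>x. \<Sum>i\<in>I. c i * g i x) = (\<Sum>i\<in>I. cnj (c i) * ip f (g i))"
proof -
  have "ip (\<lambda>x. \<Sum>i\<in>I. c i * g i x) f = (\<Sum>i\<in>I. c i * ip (g i) f)"
    using assms(1)
    by (induction I rule: infinite_finite_induct)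
      (auto simp: assms(2) ip_zero_left ip_add ip_scale scale_mem lincomb_mem)
  then have "cnj (ip (\<lambda>x. \<Sum>i\<in>I. c i * g i x) f) = (\<Sum>i\<in>I. cnj (c i) * ip f (g i))"
    using assms ip_commute[of _ f] by simp
  then show ?thesis using assms ip_commute[of "\<lambda>x. \<Sum>i\<in>I. c i * g i x" f] lincomb_mem by metis
qed

lemma ip_self: "f \<in> H \<Longrightarrow> ip f f = of_real ((ip_norm ip f)\<^sup>2)"
proof -
  assume f: "f \<in> H"
  have "Im (ip f f) = 0" using ip_commute[OF f f] by (metis Reals_cnj_iff complex_is_Real_iff)
  moreover have "0 \<le> Re (ip f f)" using ip_pos[OF f] ip_zero_left[OF f] by (cases "f = (\<lambda>x. 0)") auto
  ultimately show ?thesis by (simp add: ip_norm_def complex_eq_iff)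
qed

lemma ip_norm_nonneg: "f \<in> H \<Longrightarrow> 0 \<le> ip_norm ip f"
  using ip_pos[of f] ip_zero_left[of f] unfolding ip_norm_def by (cases "f = (\<lambda>x. 0)") auto

lemma Cauchy_Schwarz:
  assumes f: "f \<in> H" and g: "g \<in> H"
  shows "cmod (ip f g) \<le> ip_norm ip f * ip_norm ip g"
proof (cases "g = (\<lambda>x. 0)")
  case True
  then show ?thesis using ip_zero_right[OF f] ip_norm_nonneg[OF f] ip_norm_nonneg[OF g] by simp
next
  case False
  define G where "G = (ip_norm ip g)\<^sup>2"
  have gg: "ip g g = of_real G" unfolding G_def by (rule ip_self[OF g])
  then have G: "0 < G" using ip_pos[OF g False] by simp
  \<comment> \<open>\<open>c * g\<close> is the orthogonal projection of \<open>f\<close> onto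
    \<open>g\<close>; the inequality expresses that the remainder \<open>r\<close> has nonnegative
    squared norm.\<close>
  define c where "c = ip f g / of_real G"
  define r where "r = (\<lambda>x. f x - c * g x)"
  have r: "r \<in> H" unfolding r_def by (intro diff_mem f scale_mem g)
  have "ip r r = ip r f - cnj c * ip r g"
    using ip_diff_right[OF f scale_mem[OF g, of c] r] ip_scale_right[OF r g, of c] unfolding r_def by simp
  also have "ip r g = 0"
    using ip_diff_left[OF f scale_mem[OF g, of c] g] ip_scale[OF g g, of c] G
    unfolding r_def by (simp add: gg c_def)
  also have "ip r f = ip f f - c * cnj (ip f g)"
    using ip_diff_left[OF f scale_mem[OF g, of c] f] ip_scale[OF g f, of c] ip_commute[OF f g]
    unfolding r_def by simp
  also have "c * cnj (ip f g) = of_real ((cmod (ip f g))\<^sup>2 / G)"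
    unfolding c_def of_real_divide complex_norm_square by simp
  finally have "(ip_norm ip r)\<^sup>2 = (ip_norm ip f)\<^sup>2 - (cmod (ip f g))\<^sup>2 / G"
    unfolding ip_self[OF r] ip_self[OF f] by (metis (no_types, lifting) mult_zero_right diff_zero of_real_diff of_real_eq_iff)
  then have "(cmod (ip f g))\<^sup>2 / G \<le> (ip_norm ip f)\<^sup>2" by (metis diff_ge_0_iff_ge zero_le_power2)
  then have "(cmod (ip f g))\<^sup>2 \<le> (ip_norm ip f * ip_norm ip g)\<^sup>2"
    using G by (simp add: G_def power_mult_distrib divide_le_eq)
  then show ?thesis
    by (rule power2_le_imp_le) (intro mult_nonneg_nonneg ip_norm_nonneg f g)
qed

text \<open>By the reproducing property this represents the equal-weight quadrature rule with nodes
  \<open>p i\<close>. An indexed family is used instead of a set of nodes because lattice points may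
  coincide and must then count with multiplicity.\<close>

definition avg_section :: "'i set \<Rightarrow> ('i \<Rightarrow> 'a) \<Rightarrow> 'a \<Rightarrow> complex"
  where "avg_section I p = (\<lambda>x. \<Sum>i\<in>I. (1 / of_nat (card I)) * kernel_section X K (p i) x)"

lemma avg_section_mem: "(\<And>i. i \<in> I \<Longrightarrow> p i \<in> X) \<Longrightarrow> avg_section I p \<in> H"
  unfolding avg_section_def by (intro lincomb_mem section_mem)

lemma ip_avg_section:
  assumes "\<And>i. i \<in> I \<Longrightarrow> p i \<in> X" "f \<in> H"
  shows "ip f (avg_section I p) = (1 / of_nat (card I)) * (\<Sum>i\<in>I. f (p i))"
  unfolding avg_section_def
  using assms by (subst ip_lincomb_right) (auto simp: section_mem reproducing[symmetric] sum_distrib_left)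

end

section \<open>The Korobov kernel\<close>

text \<open>The periodic zeta function, symmetrised over positive and negative frequencies. It is
  the one-dimensional factor from which the Korobov kernel is built.\<close>

definition period_zeta :: "real \<Rightarrow> real \<Rightarrow> complex"
  where "period_zeta a t = (\<Sum>\<^sub>\<infinity>h\<in>- {0::int}.
    of_real (1 / \<bar>real_of_int h\<bar> powr a) * exp (2 * of_real pi * \<i> * of_real (real_of_int h * t)))"

lemma norm_exp_2pi_i [simp]: "norm (exp (2 * of_real pi * \<i> * of_real t)) = 1"
  using norm_exp_i_times[of "2 * pi * t"] by (simp add: ac_simps)

lemma norm_period_zeta_term:
  "norm (of_real (1 / \<bar>real_of_int h\<bar> powr a) * exp (2 * of_real pi * \<i> * of_real (real_of_int h * t)))
     = 1 / \<bar>real_of_int h\<bar> powr a"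
  by (simp only: norm_mult norm_exp_2pi_i norm_of_real) simp

lemma has_sum_period_zeta:
  assumes "1 < a"
  shows "((\<lambda>h. of_real (1 / \<bar>real_of_int h\<bar> powr a) * exp (2 * of_real pi * \<i> * of_real (real_of_int h * t)))
           has_sum period_zeta a t) (- {0})"
  unfolding period_zeta_def
  by (rule has_sum_infsum, rule abs_summable_summable, unfold norm_period_zeta_term)
    (rule has_sum_imp_summable[OF has_sum_nonzero_int_powr[OF assms]])

lemma period_zeta_0: "1 < a \<Longrightarrow> period_zeta a 0 = of_real (2 * real_zeta a)"
  using has_sum_period_zeta[of a 0] has_sum_of_real[OF has_sum_nonzero_int_powr[of a], where 'a=complex]
  by (simp add: has_sum_unique)

text \<open>The terms have norms independent of \<open>t\<close>, so the M-test gives uniform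
  convergence on the whole line.\<close>

lemma isCont_period_zeta:
  assumes "1 < a"
  shows "isCont (period_zeta a) t"
proof -
  have "uniform_limit UNIV (\<lambda>F t. \<Sum>h\<in>F. of_real (1 / \<bar>real_of_int h\<bar> powr a) * exp (2 * of_real pi * \<i> * of_real (real_of_int h * t)))
          (period_zeta a) (finite_subsets_at_top (- {0}))"
    unfolding period_zeta_def
    by (rule Weierstrass_m_test_general[OF _ has_sum_imp_summable[OF has_sum_nonzero_int_powr[OF assms]]])
      (unfold norm_period_zeta_term, simp)
  then have "continuous_on UNIV (period_zeta a)"
    by (rule uniform_limit_theorem[rotated], simp)
      (intro always_eventually allI continuous_on_sum continuous_on_mult_left continuous_on_exp
        continuous_on_of_real continuous_on_id)
  then show ?thesis by (simp add: continuous_on_eq_continuous_at)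
qed

text \<open>Averaging over the shifts k/M annihilates every frequency that is not a multiple of
  \<open>M\<close>. The surviving terms are bounded in norm by the zeta sum over the nonzero
  multiples of \<open>M\<close>.\<close>

lemma norm_grid_avg_period_zeta_le:
  assumes "1 < a" "0 < M"
  shows "norm ((\<Sum>k<M. period_zeta a (t - real k / real M)) / of_nat M) \<le> 2 * real_zeta a / real M powr a"
proof -
  let ?e = "\<lambda>x. exp (2 * of_real pi * \<i> * of_real x) :: complex"
  have "((\<lambda>h. \<Sum>k<M. of_real (1 / \<bar>real_of_int h\<bar> powr a) * ?e (real_of_int h * (t - real k / real M)))
          has_sum (\<Sum>k<M. period_zeta a (t - real k / real M))) (- {0})"
    by (intro has_sum_sum has_sum_period_zeta assms)
  also have "(\<lambda>h. \<Sum>k<M. of_real (1 / \<bar>real_of_int h\<bar> powr a) * ?e (real_of_int h * (t - real k / real M)))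
    = (\<lambda>h. if int M dvd h then of_nat M * (of_real (1 / \<bar>real_of_int h\<bar> powr a) * ?e (real_of_int h * t)) else 0)"
  proof
    fix h :: int
    have "(\<Sum>k<M. of_real (1 / \<bar>real_of_int h\<bar> powr a) * ?e (real_of_int h * (t - real k / real M)))
      = (\<Sum>k<M. (of_real (1 / \<bar>real_of_int h\<bar> powr a) * ?e (real_of_int h * t)) * ?e (real k * real_of_int (- h) / real M))"
      by (intro sum.cong refl) (simp add: algebra_simps flip: exp_add)
    also have "\<dots> = of_real (1 / \<bar>real_of_int h\<bar> powr a) * ?e (real_of_int h * t) * (if int M dvd - h then of_nat M else 0)"
      by (simp only: sum_exp_residues[OF assms(2)] flip: sum_distrib_left)
    finally show "(\<Sum>k<M. of_real (1 / \<bar>real_of_int h\<bar> powr a) * ?e (real_of_int h * (t - real k / real M)))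
      = (if int M dvd h then of_nat M * (of_real (1 / \<bar>real_of_int h\<bar> powr a) * ?e (real_of_int h * t)) else 0)"
      by simp
  qed
  finally have "((\<lambda>h. of_nat M * (of_real (1 / \<bar>real_of_int h\<bar> powr a) * ?e (real_of_int h * t))) has_sum
      (\<Sum>k<M. period_zeta a (t - real k / real M))) {h. h \<noteq> 0 \<and> int M dvd h}"
    by (rule has_sum_cong_neutral[THEN iffD1, rotated -1]) auto
  moreover have "((\<lambda>h::int. real M * (1 / \<bar>real_of_int h\<bar> powr a)) has_sum real M * (2 * real_zeta a / real M powr a)) {h. h \<noteq> 0 \<and> int M dvd h}"
    by (intro has_sum_cmult_right has_sum_multiples_powr assms)
  ultimately have "norm (\<Sum>k<M. period_zeta a (t - real k / real M)) \<le> real M * (2 * real_zeta a / real M powr a)"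
    by (rule norm_infsum_le) (simp only: norm_mult norm_exp_2pi_i norm_of_real, simp)
  then show ?thesis using assms by (simp add: norm_divide divide_simps mult.commute)
qed

lemma has_sum_prod_period_zeta:
  assumes "1 < a" "finite u"
  shows "((\<lambda>h. of_real (freq_weight a u h) * exp (2 * of_real pi * \<i> * of_real (\<Sum>j\<in>u. real_of_int (h j) * t j)))
            has_sum (\<Prod>j\<in>u. period_zeta a (t j))) (freqs u)"
proof -
  let ?f = "\<lambda>j h. of_real (1 / \<bar>real_of_int h\<bar> powr a) * exp (2 * of_real pi * \<i> * of_real (real_of_int h * t j)) :: complex"
  have eq: "of_real (freq_weight a u h) * exp (2 * of_real pi * \<i> * of_real (\<Sum>j\<in>u. real_of_int (h j) * t j))
      = (\<Prod>j\<in>u. ?f j (h j))" for h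
  proof -
    have "exp (2 * of_real pi * \<i> * of_real (\<Sum>j\<in>u. real_of_int (h j) * t j))
      = (\<Prod>j\<in>u. exp (2 * of_real pi * \<i> * of_real (real_of_int (h j) * t j)) :: complex)"
      by (simp only: of_real_sum sum_distrib_left exp_sum[OF assms(2)])
    then show ?thesis by (simp only: freq_weight_def of_real_prod prod.distrib)
  qed
  have "(\<lambda>h. of_real (freq_weight a u h) * exp (2 * of_real pi * \<i> * of_real (\<Sum>j\<in>u. real_of_int (h j) * t j)) :: complex)
      summable_on freqs u"
    by (rule abs_summable_summable, simp only: norm_mult norm_exp_2pi_i)
      (use has_sum_imp_summable[OF has_sum_freq_weight[OF assms]] in \<open>simp add: freq_weight_nonneg\<close>)
  moreover have "infsum (\<lambda>h. \<Prod>j\<in>u. ?f j (h j)) (freqs u) = (\<Prod>j\<in>u. period_zeta a (t j))"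
    unfolding freqs_def period_zeta_def
    by (rule infsum_prod_PiE_abs[OF assms(2)], unfold norm_period_zeta_term)
      (rule has_sum_imp_summable[OF has_sum_nonzero_int_powr[OF assms(1)]])
  ultimately show ?thesis unfolding has_sum_iff eq by simp
qed

lemma korobov_kernel_eq:
  assumes "1 < \<alpha>"
  shows "korobov_kernel s \<alpha> \<gamma> x y
    = 1 + (\<Sum>u\<in>Pow {1..s} - {{}}. of_real (\<gamma> u) * (\<Prod>j\<in>u. period_zeta \<alpha> (x j - y j)))"
proof -
  have "(\<Sum>\<^sub>\<infinity>h\<in>(\<Pi>\<^sub>E j\<in>u. - {0 :: int}).
             exp (2 * of_real pi * \<i> * of_real (\<Sum>j\<in>u. real_of_int (h j) * (x j - y j)))
               / of_real (\<Prod>j\<in>u. \<bar>real_of_int (h j)\<bar> powr \<alpha>))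
         = (\<Prod>j\<in>u. period_zeta \<alpha> (x j - y j))" if "u \<in> Pow {1..s} - {{}}" for u
    using infsumI[OF has_sum_prod_period_zeta[OF assms, of u "\<lambda>j. x j - y j"]] that
    by (auto simp: freqs_def freq_weight_def prod_dividef finite_subset mult.commute)
  then show ?thesis unfolding korobov_kernel_def by simp
qed

section \<open>Riemann sums over the cube\<close>

text \<open>Index of the cell of [0,1] that contains \<open>t\<close>. The floor alone would give
  \<open>M\<close> at t = 1; the minimum puts this endpoint into the last cell, which is accordingly
  closed in \<open>cell_interval\<close>.\<close>

definition cell :: "nat \<Rightarrow> real \<Rightarrow> nat"
  where "cell M t = min (nat \<lfloor>real M * t\<rfloor>) (M - 1)"

definition cell_interval :: "nat \<Rightarrow> nat \<Rightarrow> real set"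
  where "cell_interval M k =
    (if k = M - 1 then {real k / real M..1} else {real k / real M..<(real k + 1) / real M})"

definition grid :: "nat \<Rightarrow> nat \<Rightarrow> (nat \<Rightarrow> nat) set"
  where "grid s M = (\<Pi>\<^sub>E j\<in>{1..s}. {..<M})"

definition grid_point :: "nat \<Rightarrow> nat \<Rightarrow> (nat \<Rightarrow> nat) \<Rightarrow> nat \<Rightarrow> real"
  where "grid_point s M k = (\<lambda>j\<in>{1..s}. real (k j) / real M)"

lemma cell_less: "0 < M \<Longrightarrow> cell M t < M"
  by (simp add: cell_def min_def) linarith

lemma mem_cell_interval_iff:
  assumes "0 < M" "k < M" "0 \<le> t" "t \<le> 1"
  shows "t \<in> cell_interval M k \<longleftrightarrow> cell M t = k"
proof -
  have Mt: "0 \<le> real M * t" using assms by simp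
  have le: "i \<le> nat \<lfloor>real M * t\<rfloor> \<longleftrightarrow> real i / real M \<le> t" for i
    using assms Mt by (simp add: nat_le_iff le_nat_iff le_floor_iff divide_simps mult.commute)
  show ?thesis
  proof (cases "k = M - 1")
    case True
    then show ?thesis using assms le[of k] by (auto simp: cell_interval_def cell_def min_def)
  next
    case False
    then have "cell M t = k \<longleftrightarrow> nat \<lfloor>real M * t\<rfloor> = k" using assms by (auto simp: cell_def min_def)
    also have "\<dots> \<longleftrightarrow> k \<le> nat \<lfloor>real M * t\<rfloor> \<and> \<not> Suc k \<le> nat \<lfloor>real M * t\<rfloor>" by auto
    finally show ?thesis using False le[of k] le[of "Suc k"] by (auto simp: cell_interval_def add.commute)
  qed
qed

lemma cell_interval_subset:
  assumes "k < M"
  shows "cell_interval M k \<subseteq> {0..1}"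
proof -
  have "0 \<le> real k / real M" "(real k + 1) / real M \<le> 1" using assms by (auto simp: divide_simps)
  moreover have "{x..1} \<subseteq> {0..1}" "y \<le> 1 \<Longrightarrow> {x..<y} \<subseteq> {0..1}" if "0 \<le> x" for x y :: real
    using that by auto
  ultimately show ?thesis unfolding cell_interval_def by simp
qed

lemma emeasure_cell_interval:
  assumes "k < M"
  shows "emeasure lborel (cell_interval M k) = ennreal (1 / real M)"
proof (cases "k = M - 1")
  case True
  then have "1 - real k / real M = 1 / real M" "real k / real M \<le> 1"
    using assms by (auto simp: field_simps of_nat_diff)
  then show ?thesis using True by (simp add: cell_interval_def)
next
  case False
  have "(real k + 1) / real M - real k / real M = 1 / real M" "real k / real M \<le> (real k + 1) / real M"
    using assms by (auto simp: field_simps)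
  then show ?thesis using False by (simp add: cell_interval_def)
qed

lemma cell_tendsto:
  assumes "0 \<le> t" "t \<le> 1"
  shows "(\<lambda>M. real (cell (Suc M) t) / real (Suc M)) \<longlonglongrightarrow> t"
proof (rule tendsto_sandwich)
  have *: "real M * t - 1 \<le> real (cell M t) \<and> real (cell M t) \<le> real M * t" if "0 < M" for M
  proof -
    have Mt: "0 \<le> real M * t" "real M * t \<le> real M * 1" using assms by (auto intro!: mult_left_mono simp del: mult_1_right)
    have "real (nat \<lfloor>real M * t\<rfloor>) = of_int \<lfloor>real M * t\<rfloor>" using Mt by simp
    moreover have "of_int \<lfloor>real M * t\<rfloor> \<le> real M * t" "real M * t - 1 < of_int \<lfloor>real M * t\<rfloor>" by linarith+
    moreover have "real (M - 1) = real M - 1" using that by (simp add: of_nat_diff)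
    ultimately show ?thesis using Mt unfolding cell_def of_nat_min by linarith
  qed
  have **: "t - 1 / real M \<le> real (cell M t) / real M \<and> real (cell M t) / real M \<le> t" if "0 < M" for M
  proof -
    have "(real M * t - 1) / real M \<le> real (cell M t) / real M"
      using *[OF that] by (intro divide_right_mono) auto
    moreover have "real (cell M t) / real M \<le> t"
      using *[OF that] that by (simp add: pos_divide_le_eq mult.commute)
    ultimately show ?thesis using that by (simp add: diff_divide_distrib)
  qed
  show "\<forall>\<^sub>F M in sequentially. t - 1 / real (Suc M) \<le> real (cell (Suc M) t) / real (Suc M)"
    using ** by (intro always_eventually allI) blast
  show "\<forall>\<^sub>F M in sequentially. real (cell (Suc M) t) / real (Suc M) \<le> t"
    using ** by (intro always_eventually allI) blast
  show "(\<lambda>M. t - 1 / real (Suc M)) \<longlonglongrightarrow> t"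
    using tendsto_diff[OF tendsto_const[of t] LIMSEQ_inverse_real_of_nat] by (simp add: inverse_eq_divide)
qed simp

lemma finite_grid: "finite (grid s M)" and card_grid: "card (grid s M) = M ^ s"
  by (auto simp: grid_def card_PiE intro: finite_PiE)

lemma grid_point_mem: "k \<in> grid s M \<Longrightarrow> grid_point s M k \<in> unit_cube s"
  by (force simp: grid_def grid_point_def unit_cube_def PiE_iff divide_simps)

text \<open>A grid average is the integral of the step function that takes the value of
  \<open>f\<close> at the lower corner of each box. These step functions converge pointwise by
  continuity and are dominated by the constant \<open>B\<close>, which is integrable on the cube.
  Continuity is stated for sequences converging coordinatewise, the form in which it is obtained for
  members of the Korobov space.\<close>

lemma grid_average_tendsto_integral:
  fixes f :: "(nat \<Rightarrow> real) \<Rightarrow> complex"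
  assumes bound: "\<And>x. x \<in> unit_cube s \<Longrightarrow> norm (f x) \<le> B"
    and cont: "\<And>x X. x \<in> unit_cube s \<Longrightarrow> (\<And>n. X n \<in> unit_cube s) \<Longrightarrow>
      (\<And>j. j \<in> {1..s} \<Longrightarrow> (\<lambda>n. X n j) \<longlonglongrightarrow> x j) \<Longrightarrow> (\<lambda>n. f (X n)) \<longlonglongrightarrow> f x"
  shows "(\<lambda>M. (\<Sum>k\<in>grid s (Suc M). f (grid_point s (Suc M) k)) / of_nat (Suc M ^ s))
           \<longlonglongrightarrow> (\<integral>x. f x \<partial>cube_measure s)"
proof -
  define R where "R = restrict_space lborel {0..1::real}"
  have spR: "space R = {0..1}" by (simp add: R_def space_restrict_space)
  interpret R: prob_space R
    by (rule prob_spaceI) (simp add: R_def space_restrict_space emeasure_restrict_space)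
  interpret P: finite_product_prob_space "\<lambda>_::nat. R" "{1..s}"
    by unfold_locales auto
  have cm: "cube_measure s = (\<Pi>\<^sub>M j\<in>{1..s}. R)" by (simp add: cube_measure_def R_def)
  have sp: "space (cube_measure s) = unit_cube s"
    by (simp add: cm space_PiM spR unit_cube_def)
  have fin: "finite_measure (cube_measure s)" unfolding cm by (rule P.finite_measure_axioms)
  have ef: "emeasure (cube_measure s) X < \<infinity>" for X
    using finite_measure.emeasure_finite[OF fin] by (simp add: less_top[symmetric])
  \<comment> \<open>\<open>T M x\<close> rounds \<open>x\<close> down to a grid point, and
    \<open>A M k\<close> is the box of all points rounded to the grid point of
    \<open>k\<close>.\<close>
  define T where "T M x = grid_point s M (\<lambda>j\<in>{1..s}. cell M (x j))" for M and x :: "nat \<Rightarrow> real"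
  define A where "A M k = (\<Pi>\<^sub>E j\<in>{1..s}. cell_interval M (k j))" for M and k :: "nat \<Rightarrow> nat"
  have Rset: "cell_interval M i \<in> sets R" and Rm: "R.prob (cell_interval M i) = 1 / real M" if "i < M" for i M
  proof -
    have "cell_interval M i \<in> sets borel" by (simp add: cell_interval_def)
    then show s: "cell_interval M i \<in> sets R"
      using cell_interval_subset[OF that] by (auto simp: R_def sets_restrict_space_iff)
    have "emeasure R (cell_interval M i) = ennreal (1 / real M)"
      unfolding R_def using emeasure_cell_interval[OF that] cell_interval_subset[OF that]
      by (subst emeasure_restrict_space) auto
    then show "R.prob (cell_interval M i) = 1 / real M" by (simp add: measure_def)
  qed
  have kM: "k j < M" if "k \<in> grid s M" "j \<in> {1..s}" for k M j
    using that by (auto simp: grid_def)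
  have Aset: "A M k \<in> sets (cube_measure s)" if "k \<in> grid s M" for M k
    unfolding A_def cm using Rset kM[OF that] by (intro sets_PiM_I_finite) auto
  have Am: "measure (cube_measure s) (A M k) = 1 / real (M ^ s)" if "k \<in> grid s M" for M k
  proof -
    have "measure (cube_measure s) (A M k) = (\<Prod>j\<in>{1..s}. R.prob (cell_interval M (k j)))"
      unfolding A_def cm using Rset kM[OF that] by (intro P.prob_times) auto
    also have "\<dots> = (\<Prod>j\<in>{1..s}. 1 / real M)" using Rm kM[OF that] by (intro prod.cong) auto
    finally show ?thesis by (simp add: power_divide)
  qed
  have Tmem: "T (Suc M) x \<in> unit_cube s" for M x
    unfolding T_def by (rule grid_point_mem) (auto simp: grid_def cell_less)
  have fT: "f (T M x) = (\<Sum>k\<in>grid s M. indicat_real (A M k) x *\<^sub>R f (grid_point s M k))"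
    if "x \<in> unit_cube s" "0 < M" for M x
  proof -
    have ind: "indicat_real (A M k) x = (if k = (\<lambda>j\<in>{1..s}. cell M (x j)) then 1 else 0)" if k: "k \<in> grid s M" for k
    proof -
      have "x \<in> A M k \<longleftrightarrow> (\<forall>j\<in>{1..s}. x j \<in> cell_interval M (k j))"
        using \<open>x \<in> unit_cube s\<close> by (auto simp: A_def unit_cube_def PiE_iff)
      also have "\<dots> \<longleftrightarrow> (\<forall>j\<in>{1..s}. k j = cell M (x j))"
      proof (rule ball_cong[OF refl])
        fix j assume j: "j \<in> {1..s}"
        then have "0 \<le> x j" "x j \<le> 1" using \<open>x \<in> unit_cube s\<close> by (auto simp: unit_cube_def PiE_iff)
        then show "x j \<in> cell_interval M (k j) \<longleftrightarrow> k j = cell M (x j)"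
          using mem_cell_interval_iff[OF \<open>0 < M\<close> kM[OF k j]] by auto
      qed
      also have "\<dots> \<longleftrightarrow> k = (\<lambda>j\<in>{1..s}. cell M (x j))"
        using k by (auto simp: grid_def PiE_iff extensional_def fun_eq_iff)
      finally show ?thesis by (simp add: indicator_def)
    qed
    have "(\<lambda>j\<in>{1..s}. cell M (x j)) \<in> grid s M" using that by (auto simp: grid_def cell_less)
    then show ?thesis
      using finite_grid[of s M] by (simp add: ind T_def if_distrib[of "\<lambda>c. c *\<^sub>R _"] cong: if_cong)
  qed
  have int_ind: "integrable (cube_measure s) (\<lambda>x. indicat_real (A M k) x *\<^sub>R c)" if "k \<in> grid s M" for M k and c :: complex
    using Aset[OF that] ef by (intro integrable_scaleR_left integrable_real_indicator)
  \<comment> \<open>This is \<open>f\<close> composed with the rounding map, written as a finite sum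
    over boxes so that its integral can be read off.\<close>
  define F where "F M x = (\<Sum>k\<in>grid s (Suc M). indicat_real (A (Suc M) k) x *\<^sub>R f (grid_point s (Suc M) k))" for M x
  have Fint: "integrable (cube_measure s) (F M)" for M
    unfolding F_def by (intro Bochner_Integration.integrable_sum int_ind)
  have Fval: "(\<integral>x. F M x \<partial>cube_measure s) = (\<Sum>k\<in>grid s (Suc M). f (grid_point s (Suc M) k)) / of_nat (Suc M ^ s)" for M
  proof -
    have "(\<integral>x. F M x \<partial>cube_measure s)
       = (\<Sum>k\<in>grid s (Suc M). (\<integral>x. indicat_real (A (Suc M) k) x *\<^sub>R f (grid_point s (Suc M) k) \<partial>cube_measure s))"
      unfolding F_def by (intro Bochner_Integration.integral_sum int_ind)
    also have "\<dots> = (\<Sum>k\<in>grid s (Suc M). f (grid_point s (Suc M) k) / of_nat (Suc M ^ s))"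
    proof (rule sum.cong[OF refl])
      fix k assume k: "k \<in> grid s (Suc M)"
      have "A (Suc M) k \<inter> space (cube_measure s) = A (Suc M) k" using Aset[OF k] by (simp add: sets.Int_space_eq2)
      then show "(\<integral>x. indicat_real (A (Suc M) k) x *\<^sub>R f (grid_point s (Suc M) k) \<partial>cube_measure s)
          = f (grid_point s (Suc M) k) / of_nat (Suc M ^ s)"
        using Aset[OF k] Am[OF k] ef
        by (subst integral_scaleR_left) (auto intro!: integrable_real_indicator simp: scaleR_conv_of_real)
    qed
    finally show ?thesis by (simp add: sum_divide_distrib)
  qed
  have Flim: "(\<lambda>M. F M x) \<longlonglongrightarrow> f x" if x: "x \<in> unit_cube s" for x
  proof -
    have "(\<lambda>M. f (T (Suc M) x)) \<longlonglongrightarrow> f x"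
    proof (rule cont[OF x Tmem])
      fix j assume j: "j \<in> {1..s}"
      then have "0 \<le> x j" "x j \<le> 1" using x by (auto simp: unit_cube_def PiE_iff)
      then show "(\<lambda>n. T (Suc n) x j) \<longlonglongrightarrow> x j"
        using j cell_tendsto[of "x j"] by (simp add: T_def grid_point_def)
    qed
    then show ?thesis using fT[OF x] by (simp add: F_def)
  qed
  have "(\<lambda>M. \<integral>x. F M x \<partial>cube_measure s) \<longlonglongrightarrow> (\<integral>x. f x \<partial>cube_measure s)"
  proof (rule integral_dominated_convergence[where w = "\<lambda>_. B"])
    show Fm: "F M \<in> borel_measurable (cube_measure s)" for M using Fint by (rule borel_measurable_integrable)
    \<comment> \<open>Measurability of \<open>f\<close> is inherited from the step functions through
      their pointwise limit.\<close>
    show "f \<in> borel_measurable (cube_measure s)"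
      by (rule borel_measurable_LIMSEQ_metric[where f = F, OF Fm]) (simp add: Flim sp)
    show "integrable (cube_measure s) (\<lambda>_. B)" using fin by (rule finite_measure.integrable_const)
    show "AE x in cube_measure s. (\<lambda>M. F M x) \<longlonglongrightarrow> f x" by (rule AE_I2) (simp add: Flim sp)
    have "norm (F M x) \<le> B" if "x \<in> unit_cube s" for M x
      using fT[OF that, of "Suc M"] bound[OF Tmem[of M x]] by (simp add: F_def)
    then show "AE x in cube_measure s. norm (F M x) \<le> B" for M by (intro AE_I2) (simp add: sp)
  qed
  then show ?thesis by (simp only: Fval)
qed

section \<open>Congruences over the search space\<close>

text \<open>Two solutions differ by a multiple of q = M / g with g = gcd h M, since h / g is a unit
  modulo q. The range splits into g blocks of length q, and each block holds at most one
  solution.\<close>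

lemma card_linear_congruence_le:
  fixes r h :: int
  assumes "0 < M"
  shows "int (card {z \<in> {0..<int M}. int M dvd r + h * z}) \<le> gcd h (int M)"
proof -
  define g where "g = gcd h (int M)"
  define q where "q = int M div g"
  define S where "S = {z \<in> {0..<int M}. int M dvd r + h * z}"
  have g: "0 < g" "int M = q * g" using assms by (auto simp: g_def q_def)
  then have q: "0 < q" using assms by (metis of_nat_0_less_iff zero_less_mult_pos2)
  have cop: "coprime (h div g) q"
    unfolding q_def g_def using assms by (intro div_gcd_coprime) auto
  have qdvd: "q dvd z - z'" if "z \<in> S" "z' \<in> S" for z z'
  proof -
    have "int M dvd (r + h * z) - (r + h * z')" using that unfolding S_def by (intro dvd_diff) auto
    then have "q * g dvd g * ((h div g) * (z - z'))"
      unfolding g(2)[symmetric] by (simp add: g_def algebra_simps flip: mult.assoc)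
    then have "q dvd (h div g) * (z - z')" using g by (simp add: mult.commute)
    then show ?thesis using cop by (metis coprime_commute coprime_dvd_mult_right_iff)
  qed
  have "inj_on (\<lambda>z. z div q) S"
  proof (rule inj_onI)
    fix z z' assume zz: "z \<in> S" "z' \<in> S" "z div q = z' div q"
    have "z mod q = z' mod q" using qdvd[OF zz(1,2)] by (simp add: mod_eq_dvd_iff)
    then show "z = z'" using zz(3) by (metis div_mult_mod_eq)
  qed
  moreover have "(\<lambda>z. z div q) ` S \<subseteq> {0..<g}"
  proof (rule image_subsetI)
    fix z assume "z \<in> S"
    then have z: "0 \<le> z" "z < g * q" using g by (auto simp: S_def mult.commute)
    have "z div q * q \<le> z" using q by (simp add: minus_mod_eq_div_mult[symmetric])
    then have "z div q * q < g * q" using z by linarith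
    then show "z div q \<in> {0..<g}" using z q by (simp add: pos_imp_zdiv_nonneg_iff)
  qed
  ultimately have "card S \<le> card {0..<g}" by (intro card_inj_on_le[of "\<lambda>z. z div q"]) auto
  then have "int (card S) \<le> g" using g(1) by simp
  then show ?thesis unfolding S_def g_def .
qed

text \<open>Being coprime to \<open>b ^ m\<close> and to \<open>b ^ (m - k)\<close> both mean not
  being divisible by the prime \<open>b\<close>, as m - k > 0. The endpoint
  \<open>b ^ (m - k)\<close>, which \<open>totatives\<close> admits by range, is not coprime to
  itself. The size of the search space thereby becomes a totient.\<close>

lemma search_space_eq_totatives:
  assumes "prime b" "k < m"
  shows "search_space b m k = int ` totatives (b ^ (m - k))"
proof (intro equalityI subsetI)
  have b: "1 < b" using assms prime_gt_1_nat by blast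
  have cop: "gcd (int n) (int (b ^ m)) = 1 \<longleftrightarrow> coprime n (b ^ (m - k))" for n
  proof -
    have "gcd (int n) (int (b ^ m)) = 1 \<longleftrightarrow> coprime n (b ^ m)"
      unfolding gcd_int_int_eq coprime_iff_gcd_eq_1 by simp
    then show ?thesis using assms by simp
  qed
  {
    fix z assume z: "z \<in> search_space b m k"
    then have z': "1 \<le> z" "z \<le> int (b ^ (m - k)) - 1" "gcd z (int (b ^ m)) = 1"
      using assms by (auto simp: search_space_def)
    then have "z = int (nat z)" "nat z > 0" "nat z \<le> b ^ (m - k)" by linarith+
    then have "z = int (nat z)" "nat z \<in> totatives (b ^ (m - k))"
      using z'(3) cop[of "nat z"] unfolding in_totatives_iff by metis+
    then show "z \<in> int ` totatives (b ^ (m - k))" by blast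
  next
    fix z assume "z \<in> int ` totatives (b ^ (m - k))"
    then obtain n where n: "z = int n" "0 < n" "n \<le> b ^ (m - k)" "coprime n (b ^ (m - k))"
      by (auto simp: in_totatives_iff)
    have "1 < b ^ (m - k)" using b assms by (intro one_less_power) auto
    then have "n \<noteq> b ^ (m - k)" using n(4) by auto
    then have "int n < int (b ^ (m - k))" using n(3) by linarith
    then have "z \<in> {1..int b ^ (m - k) - 1}" using n by auto
    then show "z \<in> search_space b m k"
      using n assms cop[of n] by (simp add: search_space_def)
  }
qed

text \<open>The totient of b^n is b^(n-1) * (b - 1), and b \<le> 2 * (b - 1) since b \<ge>
  2.\<close>

lemma card_search_space:
  assumes "prime b"
  shows "finite (search_space b m k)" "0 < card (search_space b m k)"
    and "k < m \<Longrightarrow> b ^ (m - k) \<le> 2 * card (search_space b m k)"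
proof -
  have b: "2 \<le> b" using assms prime_ge_2_nat by blast
  show fin: "finite (search_space b m k)"
    by (auto simp: search_space_def intro: finite_subset[of _ "{1..int b ^ (m - k) - 1}"])
  show le: "b ^ (m - k) \<le> 2 * card (search_space b m k)" if "k < m"
  proof -
    have "card (search_space b m k) = b ^ (m - k - 1) * (b - 1)"
      using assms that by (simp add: search_space_eq_totatives card_image totient_prime_power flip: totient_def)
    moreover have "b ^ (m - k) = b ^ (m - k - 1) * b"
      using that by (metis power_minus_mult zero_less_diff)
    moreover have "b ^ (m - k - 1) * b \<le> b ^ (m - k - 1) * (2 * (b - 1))"
      using b by (intro mult_left_mono) auto
    ultimately show ?thesis by (simp add: ac_simps)
  qed
  show "0 < card (search_space b m k)"
  proof (cases "k < m")
    case True
    then show ?thesis using le b by (metis gr0I mult_0_right not_le pos2 zero_less_power order_less_le_trans)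
  qed (simp add: search_space_def)
qed

text \<open>This is the one-dimensional core of the averaging argument: \<open>h\<close> is the
  frequency in the varied coordinate and \<open>c\<close> the contribution of all the others. The
  bound is uniform in \<open>c\<close>.\<close>

lemma infsum_congruence_count_le:
  fixes b k m :: nat and c :: int
  assumes b: "prime b" and a: "1 < a"
  defines "Z \<equiv> search_space b m k"
  shows "infsum (\<lambda>h::int. real (card {z \<in> Z. int (b ^ m) dvd c + h * (int b ^ k * z)}) / \<bar>real_of_int h\<bar> powr a) (- {0})
           \<le> real (card Z) * (2 * real b ^ k / real (b ^ m)) * (2 * real_zeta a)"
    (is "?S \<le> _")
    and "(\<lambda>h::int. real (card {z \<in> Z. int (b ^ m) dvd c + h * (int b ^ k * z)}) / \<bar>real_of_int h\<bar> powr a) summable_on (- {0})"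
proof -
  define cnt where "cnt h = card {z \<in> Z. int (b ^ m) dvd c + h * (int b ^ k * z)}" for h
  have b0: "0 < b" using b prime_gt_0_nat by blast
  have fin: "finite Z" and pos: "0 < card Z"
    and half: "k < m \<Longrightarrow> b ^ (m - k) \<le> 2 * card Z"
    using card_search_space[OF b, where m=m and k=k] unfolding Z_def by auto
  have sm: "(\<lambda>h::int. 1 / \<bar>real_of_int h\<bar> powr a) summable_on (- {0})"
    using has_sum_nonzero_int_powr[OF a] by (rule has_sum_imp_summable)
  have cnt_le: "cnt h \<le> card Z" for h unfolding cnt_def using fin by (intro card_mono) auto
  show sm': "(\<lambda>h::int. real (cnt h) / \<bar>real_of_int h\<bar> powr a) summable_on (- {0})"
    by (rule summable_on_comparison_test[OF summable_on_cmult_right[OF sm, of "real (card Z)"]])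
      (use cnt_le in \<open>auto intro!: divide_right_mono\<close>)
  show "infsum (\<lambda>h::int. real (cnt h) / \<bar>real_of_int h\<bar> powr a) (- {0})
           \<le> real (card Z) * (2 * real b ^ k / real (b ^ m)) * (2 * real_zeta a)" (is "?S \<le> ?R")
  proof (cases "k < m")
    \<comment> \<open>For k \<ge> m the space is the single point 1 and the factor 2 * b^k / N is at
      least 1, so counting every \<open>z\<close> as a solution is good enough.\<close>
    case False
    then have "b ^ m \<le> b ^ k" using b0 by (intro power_increasing) auto
    then have "real (b ^ m) \<le> real (b ^ k)" by (rule of_nat_mono)
    moreover have "0 \<le> real (b ^ k)" by simp
    ultimately have "real (b ^ m) \<le> 2 * real b ^ k" unfolding of_nat_power by linarith
    then have one: "1 \<le> 2 * real b ^ k / real (b ^ m)" using b0 by (simp add: divide_simps)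
    have "?S \<le> infsum (\<lambda>h::int. real (card Z) * (1 / \<bar>real_of_int h\<bar> powr a)) (- {0})"
      using cnt_le by (intro infsum_mono[OF sm' summable_on_cmult_right[OF sm]]) (auto intro!: divide_right_mono)
    also have "\<dots> = real (card Z) * (2 * real_zeta a)"
      by (rule infsumI[OF has_sum_cmult_right[OF has_sum_nonzero_int_powr[OF a]]])
    also have "\<dots> \<le> ?R"
      using real_zeta_pos[OF a] one by (intro mult_right_mono mult_le_cancel_left1[THEN iffD2]) auto
    finally show ?thesis .
  next
    case True
    define M where "M = b ^ (m - k)"
    have M0: "0 < M" using b0 by (simp add: M_def)
    have NM: "int (b ^ m) = int b ^ k * int M"
      using True by (simp add: M_def flip: power_add)
    have Z0: "Z \<subseteq> {0..<int M}"
      using True by (auto simp: Z_def search_space_def M_def)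
    have Zc: "coprime z (int M)" if zZ: "z \<in> Z" for z
    proof -
      obtain n where "z = int n" "n \<in> totatives M"
        using zZ unfolding Z_def search_space_eq_totatives[OF b True] M_def by blast
      then show ?thesis by (simp add: in_totatives_iff)
    qed
    have key: "?S \<le> 2 * real_zeta a"
    \<comment> \<open>Every term h * b^k * z is divisible by b^k, hence there is no solution unless
      \<open>c\<close> is too. In that case b^k cancels and a congruence modulo \<open>M\<close>
      remains.\<close>
    proof (cases "int b ^ k dvd c")
      case False
      have "cnt h = 0" for h
      proof -
        have "\<not> int (b ^ m) dvd c + h * (int b ^ k * z)" for z
        proof
          assume "int (b ^ m) dvd c + h * (int b ^ k * z)"
          then have "int b ^ k dvd c + h * (int b ^ k * z)"
            unfolding NM by (meson dvd_mult_left)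
          then show False using False by (simp add: dvd_add_left_iff)
        qed
        then show ?thesis by (simp add: cnt_def)
      qed
      then show ?thesis using real_zeta_pos[OF a] by simp
    next
      case True
      then obtain r where r: "c = int b ^ k * r" by auto
      have cnt_eq: "cnt h = card {z \<in> Z. int M dvd r + h * z}" for h
      proof -
        have "int (b ^ m) dvd c + h * (int b ^ k * z) \<longleftrightarrow> int M dvd r + h * z" for z
        proof -
          have "c + h * (int b ^ k * z) = int b ^ k * (r + h * z)" by (simp add: r algebra_simps)
          then show ?thesis unfolding NM using b0 by simp
        qed
        then show ?thesis by (simp add: cnt_def)
      qed
      txt \<open>The elements of \<open>Z\<close> are units modulo \<open>M\<close>, so a solution forces \<open>gcd h M = gcd r M\<close>: only
        multiples \<open>h\<close> of \<open>g\<close> contribute, each with at most \<open>g\<close> solutions.\<close>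
      define g where "g = nat (gcd r (int M))"
      have g0: "0 < g" and ig: "int g = gcd r (int M)" using M0 by (auto simp: g_def)
      have cnt_g: "cnt h \<le> g \<and> (cnt h \<noteq> 0 \<longrightarrow> int g dvd h)" for h
      proof (cases "cnt h = 0")
        case False
        then obtain z where z: "z \<in> Z" "int M dvd r + h * z"
          unfolding cnt_eq by (metis (mono_tags, lifting) card.empty empty_Collect_eq)
        have "gcd r (int M) = gcd (h * z) (int M)"
        proof -
          have "[- r = h * z] (mod int M)" using z(2) dvd_minus_iff[of "int M" "r + h * z"] by (simp add: cong_iff_dvd_diff)
          then have "gcd (- r) (int M) = gcd (h * z) (int M)" by (rule cong_gcd_eq)
          then show ?thesis by simp
        qed
        also have "\<dots> = gcd h (int M)"
          using Zc[OF z(1)] by (simp add: gcd_mult_right_right_cancel gcd_mult_left_right_cancel coprime_commute)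
        finally have gh: "int g = gcd h (int M)" using ig by simp
        have "cnt h \<le> card {z \<in> {0..<int M}. int M dvd r + h * z}"
          unfolding cnt_eq using Z0 by (intro card_mono) (auto intro: finite_subset[of _ "{0..<int M}"])
        also have "\<dots> \<le> g" using card_linear_congruence_le[OF M0, of r h] gh by simp
        finally show ?thesis using gh by simp
      qed simp
      have hs: "((\<lambda>h::int. real g * (1 / \<bar>real_of_int h\<bar> powr a)) has_sum real g * (2 * real_zeta a / real g powr a))
                  {h. h \<noteq> 0 \<and> int g dvd h}"
        by (intro has_sum_cmult_right has_sum_multiples_powr a g0)
      have "?S \<le> real g * (2 * real_zeta a / real g powr a)"
      proof (rule has_sum_mono_neutral[OF has_sum_infsum[OF sm'] hs])
        fix h :: int assume "h \<in> - {0} \<inter> {h. h \<noteq> 0 \<and> int g dvd h}"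
        have "real (cnt h) \<le> real g" using cnt_g by simp
        then show "real (cnt h) / \<bar>real_of_int h\<bar> powr a \<le> real g * (1 / \<bar>real_of_int h\<bar> powr a)"
          by (simp add: divide_right_mono)
      next
        fix h :: int assume "h \<in> - {0} - {h. h \<noteq> 0 \<and> int g dvd h}"
        then have "cnt h = 0" using cnt_g[of h] by auto
        then show "real (cnt h) / \<bar>real_of_int h\<bar> powr a \<le> 0" by simp
      qed auto
      \<comment> \<open>The loss of up to \<open>g\<close> solutions per frequency is outweighed by
        the sparsity of the multiples of \<open>g\<close>, which gains
        \<open>g powr - a\<close>.\<close>
      also have "\<dots> = 2 * real_zeta a * real g powr (1 - a)"
        using g0 by (simp add: powr_diff)
      also have "\<dots> \<le> 2 * real_zeta a * 1"
        using g0 a real_zeta_pos[OF a] powr_mono[of "1 - a" 0 "real g"] by (intro mult_left_mono) auto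
      finally show ?thesis by simp
    qed
    \<comment> \<open>The bound \<open>key\<close> lacks the size of the search space; it is
      inserted at the cost of a factor 2 * card Z / M, which is at least 1.\<close>
    have "real M * 1 \<le> 2 * real (card Z)" using half[OF True] unfolding M_def[symmetric] by linarith
    then have "1 \<le> 2 * real (card Z) / real M" using M0 by (simp add: divide_simps)
    moreover have "2 * real (card Z) / real M = real (card Z) * (2 * real b ^ k / real (b ^ m))"
    proof -
      have "real (b ^ m) = real b ^ k * real M" using NM by (metis of_int_mult of_int_of_nat_eq of_int_power)
      then show ?thesis using b0 by simp
    qed
    ultimately have "1 * (2 * real_zeta a) \<le> ?R"
      using real_zeta_pos[OF a] by (intro mult_right_mono) auto
    then show ?thesis using key by linarith
  qed
qed

section \<open>Dual lattice sums and their mean over the search space\<close>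

text \<open>The inner sum of the known formula for e^2. The exponent is a parameter because the
  error involves \<alpha> while the averaging takes place at the smaller exponent \<alpha> *
  l.\<close>

definition dual_sum :: "real \<Rightarrow> nat \<Rightarrow> nat set \<Rightarrow> (nat \<Rightarrow> int) \<Rightarrow> real"
  where "dual_sum a N u \<xi> = infsum (freq_weight a u) {h \<in> freqs u. int N dvd (\<Sum>j\<in>u. h j * \<xi> j)}"

lemma freq_weight_summable_on:
  assumes "1 < a" "finite u" "A \<subseteq> freqs u"
  shows "freq_weight a u summable_on A"
  using has_sum_freq_weight[OF assms(1,2)] assms(3) has_sum_imp_summable summable_on_subset_banach by blast

lemma dual_sum_nonneg: "0 \<le> dual_sum a N u \<xi>"
  unfolding dual_sum_def by (intro infsum_nonneg freq_weight_nonneg)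

lemma dual_sum_cong: "(\<And>j. j \<in> u \<Longrightarrow> \<xi> j = \<xi>' j) \<Longrightarrow> dual_sum a N u \<xi> = dual_sum a N u \<xi>'"
  unfolding dual_sum_def by (metis (mono_tags, lifting) sum.cong)

text \<open>A frequency vector on \<open>u\<close> is split into its part \<open>g\<close> on u -
  {d} and its entry \<open>y\<close> at \<open>d\<close>. Once the sum over \<open>z\<close> is
  moved inside, it counts solutions of a congruence in which \<open>g\<close> enters only through
  the constant \<open>c g\<close>. The bound for the sum over \<open>y\<close> is independent of
  \<open>g\<close>, so the sum over \<open>g\<close> contributes one zeta factor per remaining
  coordinate.\<close>

lemma sum_dual_sum_search_space_le:
  fixes b k m :: nat and \<xi> :: "int \<Rightarrow> nat \<Rightarrow> int"
  assumes b: "prime b" and a: "1 < a" and u: "finite u" "d \<in> u"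
    and \<xi>d: "\<And>z. \<xi> z d = int b ^ k * z" and \<xi>: "\<And>z z' j. j \<in> u - {d} \<Longrightarrow> \<xi> z j = \<xi> z' j"
  defines "Z \<equiv> search_space b m k"
  shows "(\<Sum>z\<in>Z. dual_sum a (b ^ m) u (\<xi> z))
           \<le> real (card Z) * (2 * real b ^ k / real (b ^ m)) * (2 * real_zeta a) ^ card u"
proof -
  define v where "v = u - {d}"
  have v: "finite v" "d \<notin> v" "u = insert d v" using u by (auto simp: v_def)
  define N where "N = b ^ m"
  define C where "C = real (card Z) * (2 * real b ^ k / real N) * (2 * real_zeta a)"
  \<comment> \<open>The coordinates other than \<open>d\<close> agree for all \<open>z\<close>, so
    the vector at z = 0 stands for all of them.\<close>
  define c where "c g = (\<Sum>j\<in>v. g j * \<xi> 0 j)" for g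
  define G where "G g y = real (card {z \<in> Z. int N dvd c g + y * (int b ^ k * z)}) / \<bar>real_of_int y\<bar> powr a" for g :: "nat \<Rightarrow> int" and y :: int
  have fin: "finite Z" using card_search_space(1)[OF b] by (simp add: Z_def)
  have sumeq: "(\<Sum>j\<in>u. h j * \<xi> z j) = c h + h d * (int b ^ k * z)" for h z
  proof -
    have "(\<Sum>j\<in>v. h j * \<xi> z j) = c h"
      unfolding c_def using \<xi> by (intro sum.cong) (auto simp: v_def)
    then show ?thesis using v by (simp add: \<xi>d)
  qed
  let ?P = "\<lambda>z h. int N dvd c h + h d * (int b ^ k * z)"
  have hs: "((\<lambda>h. \<Sum>z\<in>Z. if ?P z h then freq_weight a u h else 0) has_sum (\<Sum>z\<in>Z. dual_sum a N u (\<xi> z))) (freqs u)"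
  proof (rule has_sum_sum)
    fix z
    have "freq_weight a u summable_on {h \<in> freqs u. ?P z h}"
      by (rule freq_weight_summable_on[OF a u(1)]) auto
    then have "(freq_weight a u has_sum dual_sum a N u (\<xi> z)) {h \<in> freqs u. ?P z h}"
      unfolding dual_sum_def sumeq by (rule has_sum_infsum)
    then show "((\<lambda>h. if ?P z h then freq_weight a u h else 0) has_sum dual_sum a N u (\<xi> z)) (freqs u)"
      by (rule has_sum_cong_neutral[THEN iffD1, rotated -1]) auto
  qed
  have bij: "bij_betw (\<lambda>(g, y). g(d := y)) (freqs v \<times> - {0}) (freqs u)"
  proof -
    have "inj_on (\<lambda>(g, y). g(d := y)) (freqs v \<times> - {0})"
      unfolding freqs_def using v(2) by (rule inj_combinator')
    moreover have "(\<lambda>(g, y). g(d := y)) ` (freqs v \<times> - {0}) = freqs u"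
      unfolding freqs_def v(3) PiE_insert_eq
      by (subst swap_product [symmetric]) (simp add: image_image case_prod_unfold)
    ultimately show ?thesis by (simp add: bij_betw_def)
  qed
  have "((\<lambda>(g, y). freq_weight a v g * G g y) has_sum (\<Sum>z\<in>Z. dual_sum a N u (\<xi> z))) (freqs v \<times> - {0})"
  proof -
    have eq: "(\<Sum>z\<in>Z. if int N dvd c (g(d := y)) + y * (int b ^ k * z) then freq_weight a u (g(d := y)) else 0) = freq_weight a v g * G g y" for g y
    proof -
      have "c (g(d := y)) = c g" using v by (auto simp: c_def intro!: sum.cong)
      moreover have "freq_weight a u (g(d := y)) = freq_weight a v g * (1 / \<bar>real_of_int y\<bar> powr a)"
      proof -
        have "(\<Prod>j\<in>v. 1 / \<bar>real_of_int ((g(d := y)) j)\<bar> powr a) = freq_weight a v g"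
          unfolding freq_weight_def using v by (intro prod.cong) auto
        then show ?thesis using v by (simp add: freq_weight_def mult.commute)
      qed
      ultimately show ?thesis
        using fin by (simp add: G_def sum.inter_filter[symmetric] mult.commute)
    qed
    show ?thesis
      by (rule has_sum_cong[THEN iffD1, OF _ has_sum_reindex_bij_betw[OF bij, THEN iffD2, OF hs]])
        (auto simp: eq)
  qed
  then have "((\<lambda>g. freq_weight a v g * infsum (G g) (- {0})) has_sum (\<Sum>z\<in>Z. dual_sum a N u (\<xi> z))) (freqs v)"
  proof (rule has_sum_SigmaD)
    fix g
    have "G g summable_on (- {0})"
      unfolding G_def N_def Z_def by (rule infsum_congruence_count_le(2)[OF b a])
    then show "((\<lambda>y. case (g, y) of (g, y) \<Rightarrow> freq_weight a v g * G g y) has_sum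
                 freq_weight a v g * infsum (G g) (- {0})) (- {0})"
      by (simp add: has_sum_cmult_right)
  qed
  moreover have "((\<lambda>g. freq_weight a v g * C) has_sum (2 * real_zeta a) ^ card v * C) (freqs v)"
    by (intro has_sum_cmult_left has_sum_freq_weight a v)
  moreover have "freq_weight a v g * infsum (G g) (- {0}) \<le> freq_weight a v g * C" for g
    unfolding G_def N_def Z_def C_def
    by (intro mult_left_mono infsum_congruence_count_le(1)[OF b a] freq_weight_nonneg)
  ultimately have "(\<Sum>z\<in>Z. dual_sum a N u (\<xi> z)) \<le> (2 * real_zeta a) ^ card v * C"
    by (rule has_sum_mono)
  also have "\<dots> = real (card Z) * (2 * real b ^ k / real N) * (2 * real_zeta a) ^ card u"
    using v by (simp add: C_def)
  finally show ?thesis by (simp add: N_def)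
qed

section \<open>The worst-case error\<close>

locale korobov_rkhs = rkhs "unit_cube s" "korobov_kernel s \<alpha> \<gamma>" H ip
  for s :: nat and \<alpha> :: real and \<gamma> :: "nat set \<Rightarrow> real"
    and H :: "((nat \<Rightarrow> real) \<Rightarrow> complex) set"
    and ip :: "((nat \<Rightarrow> real) \<Rightarrow> complex) \<Rightarrow> ((nat \<Rightarrow> real) \<Rightarrow> complex) \<Rightarrow> complex" +
  assumes \<alpha>: "1 < \<alpha>" and \<gamma>_nonneg: "\<And>u. u \<subseteq> {1..s} \<Longrightarrow> 0 \<le> \<gamma> u"
begin

abbreviation "K \<equiv> korobov_kernel s \<alpha> \<gamma>"
abbreviation "sect \<equiv> kernel_section (unit_cube s) K"
abbreviation "subs \<equiv> Pow {1..s} - {{}}"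

section \<open>Boundedness and continuity of the members of the space\<close>

definition diag :: real
  where "diag = 1 + (\<Sum>u\<in>subs. \<gamma> u * (2 * real_zeta \<alpha>) ^ card u)"

text \<open>The kernel depends only on the difference of its arguments, and each factor is
  continuous at 0. Both arguments may move, so constant sequences give the diagonal values as a
  special case.\<close>

lemma kernel_tendsto_diag:
  assumes "\<And>j. j \<in> {1..s} \<Longrightarrow> (\<lambda>n. X n j - Y n j) \<longlonglongrightarrow> 0"
  shows "(\<lambda>n. K (X n) (Y n)) \<longlonglongrightarrow> of_real diag"
proof -
  have "(\<lambda>n. period_zeta \<alpha> (X n j - Y n j)) \<longlonglongrightarrow> of_real (2 * real_zeta \<alpha>)" if "j \<in> {1..s}" for j
    using isCont_tendsto_compose[OF isCont_period_zeta[OF \<alpha>] assms[OF that]] by (simp add: period_zeta_0 \<alpha>)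
  then have "(\<lambda>n. K (X n) (Y n)) \<longlonglongrightarrow> 1 + (\<Sum>u\<in>subs. of_real (\<gamma> u) * (\<Prod>j\<in>u. of_real (2 * real_zeta \<alpha>)))"
    unfolding korobov_kernel_eq[OF \<alpha>] by (intro tendsto_intros) auto
  then show ?thesis by (simp add: diag_def)
qed

lemma kernel_diag: "K x x = of_real diag"
  using LIMSEQ_unique[OF kernel_tendsto_diag[of "\<lambda>_. x" "\<lambda>_. x"] tendsto_const] by simp

lemma ip_sect: "x \<in> unit_cube s \<Longrightarrow> y \<in> unit_cube s \<Longrightarrow> ip (sect y) (sect x) = K x y"
  using reproducing[OF section_mem, of y x] by (simp add: kernel_section_def)

lemma norm_le_ip_norm:
  assumes "f \<in> H" "x \<in> unit_cube s"
  shows "cmod (f x) \<le> ip_norm ip f * sqrt diag"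
  using Cauchy_Schwarz[OF assms(1) section_mem[OF assms(2)]]
  by (simp add: reproducing[OF assms, symmetric] ip_norm_def ip_sect assms kernel_diag)

text \<open>The increment of \<open>f\<close> is its inner product with a difference of two kernel
  sections. The squared norm of that difference consists of four kernel values, two of each sign,
  all tending to \<open>diag\<close>.\<close>

lemma tendsto_mem_rkhs:
  assumes f: "f \<in> H" and x: "x \<in> unit_cube s" and X: "\<And>n. X n \<in> unit_cube s"
    and lim: "\<And>j. j \<in> {1..s} \<Longrightarrow> (\<lambda>n. X n j) \<longlonglongrightarrow> x j"
  shows "(\<lambda>n. f (X n)) \<longlonglongrightarrow> f x"
proof -
  define r where "r n = (\<lambda>y. sect (X n) y - sect x y)" for n
  have r: "r n \<in> H" for n unfolding r_def by (intro diff_mem section_mem X x)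
  have "ip (r n) (r n) = K (X n) (X n) - K (X n) x - (K x (X n) - K x x)" for n
    unfolding r_def
    by (simp add: ip_diff_left ip_diff_right diff_mem section_mem X x ip_sect)
  moreover have "(\<lambda>n. K (X n) (X n) - K (X n) x - (K x (X n) - K x x)) \<longlonglongrightarrow>
      of_real diag - of_real diag - (of_real diag - of_real diag)"
  proof -
    have "(\<lambda>n. X n j - x j) \<longlonglongrightarrow> 0" "(\<lambda>n. x j - X n j) \<longlonglongrightarrow> 0" if "j \<in> {1..s}" for j
      using tendsto_diff[OF lim[OF that] tendsto_const[of "x j"]]
        tendsto_diff[OF tendsto_const[of "x j"] lim[OF that]] by auto
    then show ?thesis by (intro tendsto_diff kernel_tendsto_diag) auto
  qed
  ultimately have "(\<lambda>n. sqrt (Re (ip (r n) (r n)))) \<longlonglongrightarrow> sqrt (Re 0)"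
    by (intro tendsto_real_sqrt tendsto_Re) simp
  then have "(\<lambda>n. ip_norm ip f * ip_norm ip (r n)) \<longlonglongrightarrow> ip_norm ip f * 0"
    unfolding ip_norm_def by (intro tendsto_mult_left) simp
  then have "(\<lambda>n. ip_norm ip f * ip_norm ip (r n)) \<longlonglongrightarrow> 0" by simp
  moreover have "cmod (f (X n) - f x) \<le> ip_norm ip f * ip_norm ip (r n)" for n
  proof -
    have "f (X n) - f x = ip f (r n)"
      unfolding r_def using f X x by (simp add: ip_diff_right section_mem reproducing[symmetric])
    then show ?thesis using Cauchy_Schwarz[OF f r] by simp
  qed
  ultimately have "(\<lambda>n. f (X n) - f x) \<longlonglongrightarrow> 0"
    by (rule Lim_null_comparison[OF always_eventually, OF allI, rotated])
  then show ?thesis by (rule LIM_zero_cancel)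
qed

section \<open>Approximate representers of the integral\<close>

text \<open>The index is shifted by one so that the grid is nonempty for every
  \<open>M\<close>.\<close>

definition grid_section :: "nat \<Rightarrow> (nat \<Rightarrow> real) \<Rightarrow> complex"
  where "grid_section M = avg_section (grid s (Suc M)) (grid_point s (Suc M))"

lemma grid_section_mem: "grid_section M \<in> H"
  unfolding grid_section_def by (intro avg_section_mem grid_point_mem)

lemma ip_grid_section_tendsto:
  assumes "f \<in> H"
  shows "(\<lambda>M. ip f (grid_section M)) \<longlonglongrightarrow> (\<integral>x. f x \<partial>cube_measure s)"
proof -
  have "(\<lambda>M. (\<Sum>k\<in>grid s (Suc M). f (grid_point s (Suc M) k)) / of_nat (Suc M ^ s))
           \<longlonglongrightarrow> (\<integral>x. f x \<partial>cube_measure s)"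
    by (rule grid_average_tendsto_integral[OF norm_le_ip_norm[OF assms] tendsto_mem_rkhs[OF assms]])
  moreover have "ip f (grid_section M) = (\<Sum>k\<in>grid s (Suc M). f (grid_point s (Suc M) k)) / of_nat (Suc M ^ s)" for M
    unfolding grid_section_def by (simp add: ip_avg_section[OF grid_point_mem assms] card_grid)
  ultimately show ?thesis by simp
qed

text \<open>A bound for the uniform distance of \<open>grid_section M\<close> from the constant
  1.\<close>

definition grid_defect :: "nat \<Rightarrow> real"
  where "grid_defect M = (\<Sum>u\<in>subs. \<gamma> u * (2 * real_zeta \<alpha> / real (Suc M) powr \<alpha>) ^ card u)"

lemma grid_defect_tendsto: "grid_defect \<longlonglongrightarrow> 0"
proof -
  have "(\<lambda>M. real (Suc M) powr - \<alpha>) \<longlonglongrightarrow> 0"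
    using \<alpha> by (intro tendsto_neg_powr filterlim_compose[OF filterlim_real_sequentially filterlim_Suc]) auto
  then have "(\<lambda>M. 2 * real_zeta \<alpha> * real (Suc M) powr - \<alpha>) \<longlonglongrightarrow> 2 * real_zeta \<alpha> * 0"
    by (rule tendsto_mult_left)
  then have lim: "(\<lambda>M. 2 * real_zeta \<alpha> / real (Suc M) powr \<alpha>) \<longlonglongrightarrow> 0"
    by (simp add: powr_minus divide_inverse)
  have "(\<lambda>M. \<Sum>u\<in>subs. \<gamma> u * (2 * real_zeta \<alpha> / real (Suc M) powr \<alpha>) ^ card u) \<longlonglongrightarrow> (\<Sum>u\<in>subs. \<gamma> u * 0 ^ card u)"
    by (intro tendsto_sum tendsto_mult_left tendsto_power lim)
  \<comment> \<open>The empty set is excluded from \<open>subs\<close>, so every exponent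
    \<open>card u\<close> is positive.\<close>
  also have "(\<Sum>u\<in>subs. \<gamma> u * 0 ^ card u) = 0"
    by (intro sum.neutral) (auto simp: card_eq_0_iff finite_subset)
  finally show ?thesis by (simp add: grid_defect_def[abs_def])
qed

text \<open>Padding the product with factors 1 outside \<open>u\<close> lets the sum factor over all
  \<open>s\<close> coordinates; each padded coordinate then averages to 1.\<close>

lemma sum_grid_prod:
  assumes u: "u \<subseteq> {1..s}" and M: "0 < M"
  shows "(\<Sum>k\<in>grid s M. \<Prod>j\<in>u. F j (k j)) / of_nat (M ^ s)
           = (\<Prod>j\<in>u. (\<Sum>i<M. F j i) / of_nat M :: complex)"
proof -
  have eq: "(\<Prod>j\<in>u. F j) = (\<Prod>j\<in>{1..s}. if j \<in> u then F j else 1)" for F :: "nat \<Rightarrow> complex"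
    using u by (simp add: prod.If_cases Int_absorb1)
  have "(\<Sum>k\<in>grid s M. \<Prod>j\<in>u. F j (k j)) = (\<Sum>k\<in>grid s M. \<Prod>j\<in>{1..s}. if j \<in> u then F j (k j) else 1)"
    by (simp only: eq)
  also have "\<dots> = (\<Prod>j\<in>{1..s}. \<Sum>i<M. if j \<in> u then F j i else 1)"
    unfolding grid_def by (rule prod_sum_PiE[symmetric]) auto
  also have "\<dots> / of_nat (M ^ s) = (\<Prod>j\<in>{1..s}. (\<Sum>i<M. if j \<in> u then F j i else 1) / of_nat M)"
    by (simp add: prod_dividef)
  also have "\<dots> = (\<Prod>j\<in>{1..s}. if j \<in> u then (\<Sum>i<M. F j i) / of_nat M else 1)"
    using M by (intro prod.cong) auto
  also have "\<dots> = (\<Prod>j\<in>u. (\<Sum>i<M. F j i) / of_nat M)" by (simp only: eq)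
  finally show ?thesis .
qed

text \<open>The summand 1 of the kernel is preserved by averaging. The summand of a set
  \<open>u\<close> factors into one-dimensional grid averages, each of which is small.\<close>

lemma norm_grid_section_diff_le:
  assumes x: "x \<in> unit_cube s"
  shows "cmod (grid_section M x - 1) \<le> grid_defect M"
proof -
  define N where "N = Suc M"
  have G0: "of_nat (N ^ s) \<noteq> (0::complex)" by (simp add: N_def del: of_nat_Suc)
  have "grid_section M x = (\<Sum>k\<in>grid s N. K x (grid_point s N k)) / of_nat (N ^ s)"
    unfolding grid_section_def avg_section_def kernel_section_def
    using x by (simp add: N_def card_grid sum_divide_distrib)
  also have "\<dots> = (\<Sum>k\<in>grid s N. 1 + (\<Sum>u\<in>subs. of_real (\<gamma> u) * (\<Prod>j\<in>u. period_zeta \<alpha> (x j - real (k j) / real N)))) / of_nat (N ^ s)"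
  proof -
    have "(\<Prod>j\<in>u. period_zeta \<alpha> (x j - grid_point s N k j)) = (\<Prod>j\<in>u. period_zeta \<alpha> (x j - real (k j) / real N))"
      if "u \<in> subs" for u k
      using that by (intro prod.cong) (auto simp: grid_point_def)
    then show ?thesis unfolding korobov_kernel_eq[OF \<alpha>] by simp
  qed
  also have "\<dots> = 1 + (\<Sum>u\<in>subs. of_real (\<gamma> u) * ((\<Sum>k\<in>grid s N. \<Prod>j\<in>u. period_zeta \<alpha> (x j - real (k j) / real N)) / of_nat (N ^ s)))"
  proof -
    define S where "S u = (\<Sum>k\<in>grid s N. \<Prod>j\<in>u. period_zeta \<alpha> (x j - real (k j) / real N))" for u
    have "(\<Sum>k\<in>grid s N. \<Sum>u\<in>subs. of_real (\<gamma> u) * (\<Prod>j\<in>u. period_zeta \<alpha> (x j - real (k j) / real N)))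
        = (\<Sum>u\<in>subs. of_real (\<gamma> u) * S u)"
      by (subst sum.swap) (simp only: sum_distrib_left S_def)
    then show ?thesis
      using G0 unfolding S_def[symmetric]
      by (simp add: sum.distrib card_grid add_divide_distrib sum_divide_distrib)
  qed
  also have "\<dots> = 1 + (\<Sum>u\<in>subs. of_real (\<gamma> u) * (\<Prod>j\<in>u. (\<Sum>i<N. period_zeta \<alpha> (x j - real i / real N)) / of_nat N))"
    by (intro arg_cong2[of _ _ _ _ "(+)"] sum.cong refl arg_cong2[of _ _ _ _ "(*)"] sum_grid_prod[where F = "\<lambda>j i. period_zeta \<alpha> (x j - real i / real N)"])
      (auto simp: N_def)
  finally have "cmod (grid_section M x - 1) = cmod (\<Sum>u\<in>subs. of_real (\<gamma> u) * (\<Prod>j\<in>u. (\<Sum>i<N. period_zeta \<alpha> (x j - real i / real N)) / of_nat N))"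
    by simp
  also have "\<dots> \<le> (\<Sum>u\<in>subs. \<gamma> u * (2 * real_zeta \<alpha> / real N powr \<alpha>) ^ card u)"
  proof (rule sum_norm_le)
    fix u assume u: "u \<in> subs"
    have "(\<Prod>j\<in>u. cmod ((\<Sum>i<N. period_zeta \<alpha> (x j - real i / real N)) / of_nat N)) \<le> (\<Prod>j\<in>u. 2 * real_zeta \<alpha> / real N powr \<alpha>)"
      by (intro prod_mono conjI norm_grid_avg_period_zeta_le \<alpha> norm_ge_zero) (simp add: N_def)
    then have "\<gamma> u * (\<Prod>j\<in>u. cmod ((\<Sum>i<N. period_zeta \<alpha> (x j - real i / real N)) / of_nat N)) \<le> \<gamma> u * (2 * real_zeta \<alpha> / real N powr \<alpha>) ^ card u"
      using \<gamma>_nonneg[of u] u by (intro mult_left_mono) auto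
    then show "cmod (of_real (\<gamma> u) * (\<Prod>j\<in>u. (\<Sum>i<N. period_zeta \<alpha> (x j - real i / real N)) / of_nat N)) \<le> \<gamma> u * (2 * real_zeta \<alpha> / real N powr \<alpha>) ^ card u"
      using \<gamma>_nonneg[of u] u by (simp add: norm_mult prod_norm)
  qed
  finally show ?thesis by (simp add: grid_defect_def N_def)
qed

text \<open>The bound is uniform in the nodes, so it also covers nodes that change with
  \<open>M\<close>, as in the inner product of a grid section with itself.\<close>

lemma norm_ip_grid_section_diff_le:
  assumes "finite I" "I \<noteq> {}" "\<And>i. i \<in> I \<Longrightarrow> p i \<in> unit_cube s"
  shows "cmod (ip (grid_section M) (avg_section I p) - 1) \<le> grid_defect M"
proof -
  have c: "0 < card I" using assms by (simp add: card_gt_0_iff)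
  have "ip (grid_section M) (avg_section I p) - 1 = (\<Sum>i\<in>I. grid_section M (p i) - 1) / of_nat (card I)"
    using c by (simp add: ip_avg_section assms grid_section_mem sum_subtractf diff_divide_distrib)
  also have "cmod \<dots> = cmod (\<Sum>i\<in>I. grid_section M (p i) - 1) / real (card I)" by (simp add: norm_divide)
  also have "\<dots> \<le> (\<Sum>i\<in>I. grid_defect M) / real (card I)"
    by (intro divide_right_mono sum_norm_le norm_grid_section_diff_le assms) auto
  also have "\<dots> = grid_defect M" using c by simp
  finally show ?thesis .
qed

lemma ip_grid_section_avg_tendsto:
  assumes "finite I" "I \<noteq> {}" "\<And>i. i \<in> I \<Longrightarrow> p i \<in> unit_cube s"
  shows "(\<lambda>M. ip (grid_section M) (avg_section I p)) \<longlonglongrightarrow> 1"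
    and "(\<lambda>M. ip (avg_section I p) (grid_section M)) \<longlonglongrightarrow> 1"
proof -
  show *: "(\<lambda>M. ip (grid_section M) (avg_section I p)) \<longlonglongrightarrow> 1"
    by (rule LIM_zero_cancel, rule Lim_null_comparison[OF always_eventually grid_defect_tendsto])
      (intro allI norm_ip_grid_section_diff_le assms)
  have "ip (avg_section I p) (grid_section M) = cnj (ip (grid_section M) (avg_section I p))" for M
    by (intro ip_commute grid_section_mem avg_section_mem assms)
  then show "(\<lambda>M. ip (avg_section I p) (grid_section M)) \<longlonglongrightarrow> 1"
    using tendsto_cnj[OF *] by simp
qed

lemma ip_grid_section_self_tendsto: "(\<lambda>M. ip (grid_section M) (grid_section M)) \<longlonglongrightarrow> 1"
proof (rule LIM_zero_cancel, rule Lim_null_comparison[OF always_eventually grid_defect_tendsto], rule allI)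
  fix M
  have "grid s (Suc M) \<noteq> {}" by (metis card_grid card.empty power_not_zero Suc_not_Zero)
  then show "cmod (ip (grid_section M) (grid_section M) - 1) \<le> grid_defect M"
    using norm_ip_grid_section_diff_le[where I = "grid s (Suc M)" and p = "grid_point s (Suc M)" and M = M]
    by (simp add: finite_grid grid_point_mem grid_section_def)
qed

lemma lattice_point_mem: "lattice_point N s \<xi> n \<in> unit_cube s"
  by (auto simp: lattice_point_def unit_cube_def frac_lt_1 less_imp_le)

text \<open>For a fixed frequency the double sum over \<open>n\<close> and \<open>n'\<close> is a
  product of two character sums with opposite arguments. Both equal \<open>N\<close> on the dual
  lattice and vanish elsewhere.\<close>

lemma lattice_average_kernel:
  assumes N: "0 < N"
  shows "(\<Sum>n<N. \<Sum>n'<N. K (lattice_point N s \<xi> n) (lattice_point N s \<xi> n')) / of_nat (N * N)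
           = of_real (1 + (\<Sum>u\<in>subs. \<gamma> u * dual_sum \<alpha> N u \<xi>))"
proof -
  let ?e = "\<lambda>x. exp (2 * of_real pi * \<i> * of_real x) :: complex"
  let ?p = "lattice_point N s \<xi>"
  have part: "(\<Sum>n<N. \<Sum>n'<N. \<Prod>j\<in>u. period_zeta \<alpha> (?p n j - ?p n' j)) = of_nat (N * N) * of_real (dual_sum \<alpha> N u \<xi>)"
    if u: "u \<in> subs" for u
  proof -
    have fin: "finite u" using u finite_subset by auto
    have "((\<lambda>h. \<Sum>n<N. \<Sum>n'<N. of_real (freq_weight \<alpha> u h) * ?e (\<Sum>j\<in>u. real_of_int (h j) * (?p n j - ?p n' j)))
        has_sum (\<Sum>n<N. \<Sum>n'<N. \<Prod>j\<in>u. period_zeta \<alpha> (?p n j - ?p n' j))) (freqs u)"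
      by (intro has_sum_sum has_sum_prod_period_zeta \<alpha> fin)
    moreover have "(\<Sum>n<N. \<Sum>n'<N. of_real (freq_weight \<alpha> u h) * ?e (\<Sum>j\<in>u. real_of_int (h j) * (?p n j - ?p n' j)))
        = (if int N dvd (\<Sum>j\<in>u. h j * \<xi> j) then of_nat (N * N) * of_real (freq_weight \<alpha> u h) else 0)" for h
    proof -
      define c where "c = (\<Sum>j\<in>u. h j * \<xi> j)"
      have e: "?e (\<Sum>j\<in>u. real_of_int (h j) * (?p n j - ?p n' j))
          = ?e (real n * real_of_int c / real N) * ?e (real n' * real_of_int (- c) / real N)" for n n'
      proof -
        \<comment> \<open>\<open>q\<close> collects the integer parts removed by
          \<open>frac\<close>; as an integer it does not affect the exponential.\<close>
        define q where "q = (\<Sum>j\<in>u. h j * (\<lfloor>real n * real_of_int (\<xi> j) / real N\<rfloor> - \<lfloor>real n' * real_of_int (\<xi> j) / real N\<rfloor>))"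
        have "(\<Sum>j\<in>u. real_of_int (h j) * (?p n j - ?p n' j))
          = (\<Sum>j\<in>u. (real n - real n') / real N * real_of_int (h j * \<xi> j)
              - real_of_int (h j * (\<lfloor>real n * real_of_int (\<xi> j) / real N\<rfloor> - \<lfloor>real n' * real_of_int (\<xi> j) / real N\<rfloor>)))"
          using u by (intro sum.cong refl)
            (auto simp: lattice_point_def frac_def algebra_simps diff_divide_distrib subset_iff)
        also have "\<dots> = (real n - real n') / real N * real_of_int c - real_of_int q"
          unfolding sum_subtractf c_def q_def of_int_sum sum_distrib_left ..
        also have "\<dots> = real n * real_of_int c / real N + real n' * real_of_int (- c) / real N - real_of_int q"
          by (simp add: algebra_simps diff_divide_distrib)
        finally have "?e (\<Sum>j\<in>u. real_of_int (h j) * (?p n j - ?p n' j))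
          = ?e (real n * real_of_int c / real N + real n' * real_of_int (- c) / real N - real_of_int q)"
          by (rule arg_cong)
        also have "\<dots> = ?e (real n * real_of_int c / real N) * ?e (real n' * real_of_int (- c) / real N) / ?e (real_of_int q)"
          by (simp only: exp_add[symmetric] exp_diff[symmetric] of_real_add of_real_diff distrib_left right_diff_distrib)
        also have "?e (real_of_int q) = 1" by (auto simp: exp_eq_1)
        finally show ?thesis by simp
      qed
      have "(\<Sum>n<N. \<Sum>n'<N. of_real (freq_weight \<alpha> u h) * ?e (\<Sum>j\<in>u. real_of_int (h j) * (?p n j - ?p n' j)))
        = of_real (freq_weight \<alpha> u h) * ((\<Sum>n<N. ?e (real n * real_of_int c / real N)) * (\<Sum>n'<N. ?e (real n' * real_of_int (- c) / real N)))"
        unfolding e sum_product by (simp only: sum_distrib_left)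
      also have "\<dots> = (if int N dvd c then of_nat (N * N) * of_real (freq_weight \<alpha> u h) else 0)"
        unfolding sum_exp_residues[OF N] by simp
      finally show ?thesis by (simp add: c_def)
    qed
    ultimately have "((\<lambda>h. if int N dvd (\<Sum>j\<in>u. h j * \<xi> j) then of_nat (N * N) * of_real (freq_weight \<alpha> u h) else 0)
        has_sum (\<Sum>n<N. \<Sum>n'<N. \<Prod>j\<in>u. period_zeta \<alpha> (?p n j - ?p n' j))) (freqs u)"
      by simp
    then have "((\<lambda>h. of_nat (N * N) * of_real (freq_weight \<alpha> u h))
        has_sum (\<Sum>n<N. \<Sum>n'<N. \<Prod>j\<in>u. period_zeta \<alpha> (?p n j - ?p n' j))) {h \<in> freqs u. int N dvd (\<Sum>j\<in>u. h j * \<xi> j)}"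
      by (rule has_sum_cong_neutral[THEN iffD1, rotated -1]) auto
    moreover have "((\<lambda>h. of_nat (N * N) * of_real (freq_weight \<alpha> u h) :: complex)
        has_sum of_nat (N * N) * of_real (dual_sum \<alpha> N u \<xi>)) {h \<in> freqs u. int N dvd (\<Sum>j\<in>u. h j * \<xi> j)}"
      unfolding dual_sum_def
      by (intro has_sum_cmult_right has_sum_of_real has_sum_infsum freq_weight_summable_on \<alpha> fin) auto
    ultimately show ?thesis by (rule has_sum_unique)
  qed
  have "(\<Sum>n<N. \<Sum>n'<N. K (?p n) (?p n'))
    = of_nat (N * N) + (\<Sum>u\<in>subs. of_real (\<gamma> u) * (\<Sum>n<N. \<Sum>n'<N. \<Prod>j\<in>u. period_zeta \<alpha> (?p n j - ?p n' j)))"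
  proof -
    let ?P = "\<lambda>u n n'. \<Prod>j\<in>u. period_zeta \<alpha> (?p n j - ?p n' j)"
    have "(\<Sum>u\<in>subs. of_real (\<gamma> u) * (\<Sum>n<N. \<Sum>n'<N. ?P u n n'))
      = (\<Sum>u\<in>subs. \<Sum>n<N. \<Sum>n'<N. of_real (\<gamma> u) * ?P u n n')"
      by (simp only: sum_distrib_left)
    also have "\<dots> = (\<Sum>n<N. \<Sum>u\<in>subs. \<Sum>n'<N. of_real (\<gamma> u) * ?P u n n')" by (rule sum.swap)
    also have "\<dots> = (\<Sum>n<N. \<Sum>n'<N. \<Sum>u\<in>subs. of_real (\<gamma> u) * ?P u n n')"
      by (intro sum.cong[OF refl] sum.swap)
    finally show ?thesis unfolding korobov_kernel_eq[OF \<alpha>] by (simp add: sum.distrib)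
  qed
  also have "\<dots> = of_nat (N * N) + (\<Sum>u\<in>subs. of_real (\<gamma> u) * (of_nat (N * N) * of_real (dual_sum \<alpha> N u \<xi>)))"
    using part by simp
  also have "\<dots> = of_nat (N * N) * of_real (1 + (\<Sum>u\<in>subs. \<gamma> u * dual_sum \<alpha> N u \<xi>))"
    by (simp add: algebra_simps sum_distrib_left)
  finally show ?thesis using N by simp
qed

definition dual_error :: "nat \<Rightarrow> (nat \<Rightarrow> int) \<Rightarrow> real"
  where "dual_error N \<xi> = (\<Sum>u\<in>subs. \<gamma> u * dual_sum \<alpha> N u \<xi>)"

lemma dual_error_nonneg: "0 \<le> dual_error N \<xi>"
  unfolding dual_error_def by (intro sum_nonneg mult_nonneg_nonneg dual_sum_nonneg \<gamma>_nonneg) auto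

lemma ip_norm_scale: "f \<in> H \<Longrightarrow> ip_norm ip (\<lambda>x. c * f x) = cmod c * ip_norm ip f"
proof -
  assume f: "f \<in> H"
  have "ip (\<lambda>x. c * f x) (\<lambda>x. c * f x) = of_real ((cmod c)\<^sup>2) * ip f f"
    using ip_scale[OF f scale_mem[OF f, of c], of c] ip_scale_right[OF f f, of c]
    by (simp add: complex_norm_square ac_simps del: of_real_power)
  then show ?thesis by (simp add: ip_norm_def real_sqrt_mult del: of_real_power)
qed

text \<open>Let g be the lattice section and r M the grid section minus g. Inner products involving
  a grid section tend to 1, while g has squared norm 1 + E, so r M has squared norm tending to E.
  Its inner products with f tend to the integration error L f, which gives the upper bound.
  Conversely L (r M) tends to E, and homogeneity of L gives E \<le> W * sqrt E in the limit.\<close>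

lemma worst_case_error_eq:
  assumes N: "0 < N"
  shows "worst_case_error H ip N s \<xi> = sqrt (dual_error N \<xi>)"
proof -
  define p where "p = lattice_point N s \<xi>"
  define E where "E = dual_error N \<xi>"
  define g where "g = avg_section {..<N} p"
  define L where "L f = (\<integral>x. f x \<partial>cube_measure s) - (1 / of_nat N) * (\<Sum>n<N. f (p n))" for f :: "(nat \<Rightarrow> real) \<Rightarrow> complex"
  define r where "r M = (\<lambda>x. grid_section M x - g x)" for M
  have E0: "0 \<le> E" unfolding E_def by (rule dual_error_nonneg)
  have p: "p n \<in> unit_cube s" for n unfolding p_def by (rule lattice_point_mem)
  have g: "g \<in> H" unfolding g_def by (intro avg_section_mem p)
  have r: "r M \<in> H" for M unfolding r_def by (intro diff_mem grid_section_mem g)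
  have ipg: "ip f g = (1 / of_nat N) * (\<Sum>n<N. f (p n))" if "f \<in> H" for f
    unfolding g_def using ip_avg_section[OF p that, of "{..<N}"] by simp
  have gg: "ip g g = of_real (1 + E)"
  proof -
    have "ip g g = (1 / of_nat N) * (\<Sum>n<N. (\<Sum>n'<N. K (p n) (p n')) / of_nat N)"
      unfolding ipg[OF g] by (simp add: g_def avg_section_def kernel_section_def p sum_divide_distrib)
    also have "\<dots> = (\<Sum>n<N. \<Sum>n'<N. K (p n) (p n')) / of_nat (N * N)"
      by (simp flip: sum_divide_distrib)
    finally show ?thesis unfolding E_def dual_error_def p_def lattice_average_kernel[OF N] .
  qed
  have gMg: "(\<lambda>M. ip (grid_section M) g) \<longlonglongrightarrow> 1" "(\<lambda>M. ip g (grid_section M)) \<longlonglongrightarrow> 1"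
    unfolding g_def using ip_grid_section_avg_tendsto[of "{..<N}" p] p N by auto
  have iprr: "ip (r M) (r M') = ip (grid_section M) (grid_section M') - ip (grid_section M) g - (ip g (grid_section M') - ip g g)" for M M'
    unfolding r_def by (simp add: ip_diff_left ip_diff_right diff_mem grid_section_mem g)
  have "(\<lambda>M. ip (r M) (r M)) \<longlonglongrightarrow> 1 - 1 - (1 - of_real (1 + E))"
    unfolding iprr gg by (intro tendsto_diff ip_grid_section_self_tendsto gMg tendsto_const)
  then have "(\<lambda>M. sqrt (Re (ip (r M) (r M)))) \<longlonglongrightarrow> sqrt (Re (1 - 1 - (1 - of_real (1 + E))))"
    by (intro tendsto_real_sqrt tendsto_Re)
  then have norm_r: "(\<lambda>M. ip_norm ip (r M)) \<longlonglongrightarrow> sqrt E" by (simp add: ip_norm_def)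
  have L_lim: "(\<lambda>M. ip f (r M)) \<longlonglongrightarrow> L f" if "f \<in> H" for f
    unfolding r_def L_def using that
    by (simp add: ip_diff_right grid_section_mem g ipg) (intro tendsto_diff ip_grid_section_tendsto tendsto_const that)
  have L_le: "cmod (L f) \<le> ip_norm ip f * sqrt E" if "f \<in> H" for f
  proof (rule tendsto_le[OF _ tendsto_mult_left[OF norm_r] tendsto_norm[OF L_lim[OF that]]])
    show "\<forall>\<^sub>F M in sequentially. cmod (ip f (r M)) \<le> ip_norm ip f * ip_norm ip (r M)"
      by (intro always_eventually allI Cauchy_Schwarz that r)
  qed simp
  define W where "W = worst_case_error H ip N s \<xi>"
  have W: "W = (SUP f\<in>{f \<in> H. ip_norm ip f \<le> 1}. cmod (L f))"
    by (simp add: W_def worst_case_error_def L_def p_def)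
  have L_ball: "cmod (L f) \<le> sqrt E" if "f \<in> {f \<in> H. ip_norm ip f \<le> 1}" for f
    using L_le[of f] that E0 mult_right_mono[of "ip_norm ip f" 1 "sqrt E"] by auto
  have zero_ball: "(\<lambda>x. 0) \<in> {f \<in> H. ip_norm ip f \<le> 1}"
    using zero_mem by (simp add: ip_norm_def ip_zero_left)
  have "W \<le> sqrt E" unfolding W using zero_ball by (intro cSUP_least L_ball) auto
  moreover have "sqrt E \<le> W"
  proof -
    \<comment> \<open>The real supremum dominates its members only once the set is known to be
      bounded above, so the upper estimate is used first.\<close>
    have bdd: "bdd_above ((\<lambda>f. cmod (L f)) ` {f \<in> H. ip_norm ip f \<le> 1})"
      using L_ball by (intro bdd_aboveI2)
    have W_ge: "cmod (L f) \<le> W" if "f \<in> H" "ip_norm ip f \<le> 1" for f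
      unfolding W using that by (intro cSUP_upper[OF _ bdd]) auto
    have LW: "cmod (L f) \<le> W * ip_norm ip f" if f: "f \<in> H" for f
    proof (cases "ip_norm ip f = 0")
      case True
      then show ?thesis using L_le[OF f] by simp
    next
      case False
      define c where "c = complex_of_real (1 / ip_norm ip f)"
      have pos: "0 < ip_norm ip f" using False ip_norm_nonneg[OF f] by simp
      have "ip_norm ip (\<lambda>x. c * f x) = 1" using pos by (subst ip_norm_scale[OF f]) (simp add: c_def norm_divide)
      then have "cmod (L (\<lambda>x. c * f x)) \<le> W" by (intro W_ge scale_mem f) simp
      also have "L (\<lambda>x. c * f x) = c * L f"
        by (simp add: L_def algebra_simps sum_distrib_left)
      finally have "1 / ip_norm ip f * cmod (L f) \<le> W" using pos by (simp add: norm_mult c_def norm_divide)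
      then show ?thesis using pos by (simp add: divide_simps mult.commute)
    qed
    \<comment> \<open>With \<open>M\<close> fixed, L (r M) is the limit of the inner products of
      \<open>r M\<close> with \<open>r M'\<close> as \<open>M'\<close> grows; only afterwards does
      \<open>M\<close> tend to infinity.\<close>
    have "L (r M) = 1 - ip (grid_section M) g - (1 - of_real (1 + E))" for M
    proof (rule LIMSEQ_unique[OF L_lim[OF r]])
      have "(\<lambda>M'. ip (grid_section M) (grid_section M')) \<longlonglongrightarrow> 1"
        unfolding grid_section_def[of M]
        by (rule ip_grid_section_avg_tendsto[OF finite_grid _ grid_point_mem])
          (metis card_grid card.empty power_not_zero Suc_not_Zero)
      then show "(\<lambda>M'. ip (r M) (r M')) \<longlonglongrightarrow> 1 - ip (grid_section M) g - (1 - of_real (1 + E))"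
        unfolding iprr gg by (intro tendsto_diff gMg tendsto_const)
    qed
    then have "(\<lambda>M. L (r M)) \<longlonglongrightarrow> 1 - 1 - (1 - of_real (1 + E))"
      by (simp only:) (intro tendsto_diff gMg tendsto_const)
    from tendsto_le[OF _ tendsto_mult_left[OF norm_r, of W] tendsto_norm[OF this]]
    have "cmod (1 - 1 - (1 - of_real (1 + E))) \<le> W * sqrt E"
      using LW[OF r] by simp
    then have "sqrt E * sqrt E \<le> W * sqrt E" using E0 by simp
    moreover have "0 \<le> W" using order_trans[OF norm_ge_zero W_ge[of "\<lambda>x. 0"]] zero_ball by blast
    \<comment> \<open>Cancelling sqrt E requires E > 0; for E = 0 the claim is the nonnegativity of
      \<open>W\<close>.\<close>
    ultimately show ?thesis using E0 by (cases "E = 0") (auto dest: mult_right_le_imp_le simp del: real_sqrt_mult_self)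
  qed
  ultimately show ?thesis unfolding W_def E_def by linarith
qed

end

section \<open>The successive coordinate search\<close>

lemma dual_sum_powr_le:
  assumes "1 < a" "1 < a * l" "0 < l" "l \<le> 1" "finite u"
  shows "dual_sum a N u \<xi> powr l \<le> dual_sum (a * l) N u \<xi>"
proof -
  have "dual_sum a N u \<xi> powr l \<le> infsum (\<lambda>h. freq_weight a u h powr l) {h \<in> freqs u. int N dvd (\<Sum>j\<in>u. h j * \<xi> j)}"
    unfolding dual_sum_def
    by (rule infsum_powr_le) (auto simp: freq_weight_powr freq_weight_nonneg assms intro!: freq_weight_summable_on)
  then show ?thesis by (simp add: freq_weight_powr dual_sum_def)
qed

text \<open>Stated for the explicit dual lattice sum, so that the search is analysed without the
  Hilbert space. Subadditivity of the power enters at three levels: over the steps \<open>d\<close>,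
  over the sets \<open>u\<close> and over the frequencies.\<close>

lemma reduced_scs_dual_error_bound:
  fixes b m s :: nat and \<alpha> l :: real and \<gamma> :: "nat set \<Rightarrow> real" and w :: "nat \<Rightarrow> nat" and z0 z :: "nat \<Rightarrow> int"
  defines "e2 \<equiv> \<lambda>\<xi>. \<Sum>u\<in>Pow {1..s} - {{}}. \<gamma> u * dual_sum \<alpha> (b ^ m) u \<xi>"
  assumes b: "prime b" and \<gamma>: "\<And>u. u \<subseteq> {1..s} \<Longrightarrow> 0 \<le> \<gamma> u"
    and l: "0 < l" "l \<le> 1" "1 < \<alpha>" "1 < \<alpha> * l"
    and scs: "reduced_scs e2 b m s w z0 z"
  shows "e2 (\<lambda>j. int b ^ w j * z j) powr l
    \<le> 2 / real (b ^ m) * (\<Sum>d=1..s. \<Sum>u\<in>{u. d \<in> u \<and> u \<subseteq> {1..s}}.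
          \<gamma> u powr l * (2 * real_zeta (\<alpha> * l)) ^ card u * real b ^ w d)"
proof -
  define v where "v d \<zeta> = (\<lambda>j. if j < d then int b ^ w j * z j else if j = d then int b ^ w d * \<zeta> else z0 j)" for d \<zeta>
  define U where "U d = {u. d \<in> u \<and> u \<subseteq> {1..s}}" for d
  define T where "T d \<zeta> = (\<Sum>u\<in>U d. \<gamma> u * dual_sum \<alpha> (b ^ m) u (v d \<zeta>))" for d \<zeta>
  define Z where "Z d = search_space b m (w d)" for d
  define B where "B d = (\<Sum>u\<in>U d. \<gamma> u powr l * (2 * real_zeta (\<alpha> * l)) ^ card u * real b ^ w d)" for d
  have finU: "finite (U d)" and finu: "u \<in> U d \<Longrightarrow> finite u" and \<gamma>U: "u \<in> U d \<Longrightarrow> 0 \<le> \<gamma> u" for d u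
    using \<gamma> by (auto simp: U_def intro: finite_subset)
  have Z: "finite (Z d)" "0 < card (Z d)" for d
    using card_search_space[OF b, of m "w d"] by (auto simp: Z_def)
  have T_nonneg: "0 \<le> T d \<zeta>" for d \<zeta>
    unfolding T_def by (intro sum_nonneg mult_nonneg_nonneg \<gamma>U dual_sum_nonneg)
  have T_min: "T d (z d) \<le> T d \<zeta>" if d: "d \<in> {1..s}" and \<zeta>: "\<zeta> \<in> Z d" for d \<zeta>
  proof -
    \<comment> \<open>The sets in \<open>Q\<close> do not see the varied coordinate, so their part
      \<open>R\<close> is constant and minimising \<open>e2\<close> amounts to minimising
      \<open>T d\<close>.\<close>
    define Q where "Q = {u \<in> Pow {1..s} - {{}}. d \<notin> u}"
    define R where "R \<zeta> = (\<Sum>u\<in>Q. \<gamma> u * dual_sum \<alpha> (b ^ m) u (v d \<zeta>))" for \<zeta>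
    have PQ: "Pow {1..s} - {{}} = U d \<union> Q" "U d \<inter> Q = {}" and finQ: "finite Q"
      using d by (auto simp: U_def Q_def)
    have split: "e2 (v d \<zeta>) = T d \<zeta> + R \<zeta>" for \<zeta>
      unfolding e2_def T_def R_def PQ(1) by (rule sum.union_disjoint[OF finU finQ PQ(2)])
    have "R (z d) = R \<zeta>"
      unfolding R_def by (intro sum.cong refl arg_cong2[of _ _ _ _ "(*)"] dual_sum_cong) (auto simp: v_def Q_def)
    moreover have "e2 (v d (z d)) \<le> e2 (v d \<zeta>)"
      using scs d \<zeta> unfolding reduced_scs_def is_arg_min_def v_def Z_def by (meson not_le)
    ultimately show ?thesis using split by simp
  qed
  have T_bound: "T d (z d) powr l \<le> 2 / real (b ^ m) * B d" if d: "d \<in> {1..s}" for d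
  proof -
    have "real (card (Z d)) * T d (z d) powr l = (\<Sum>\<zeta>\<in>Z d. T d (z d) powr l)" by simp
    also have "\<dots> \<le> (\<Sum>\<zeta>\<in>Z d. \<Sum>u\<in>U d. \<gamma> u powr l * dual_sum (\<alpha> * l) (b ^ m) u (v d \<zeta>))"
    proof (rule sum_mono)
      fix \<zeta> assume \<zeta>: "\<zeta> \<in> Z d"
      have "T d (z d) powr l \<le> T d \<zeta> powr l"
        using T_min[OF d \<zeta>] T_nonneg l by (intro powr_mono2) auto
      also have "\<dots> \<le> (\<Sum>u\<in>U d. (\<gamma> u * dual_sum \<alpha> (b ^ m) u (v d \<zeta>)) powr l)"
        unfolding T_def using l by (intro sum_powr_le_sum_of_powr mult_nonneg_nonneg \<gamma>U dual_sum_nonneg) auto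
      also have "\<dots> = (\<Sum>u\<in>U d. \<gamma> u powr l * dual_sum \<alpha> (b ^ m) u (v d \<zeta>) powr l)"
        by (intro sum.cong refl powr_mult)
      also have "\<dots> \<le> (\<Sum>u\<in>U d. \<gamma> u powr l * dual_sum (\<alpha> * l) (b ^ m) u (v d \<zeta>))"
        using l finu by (intro sum_mono mult_left_mono dual_sum_powr_le) auto
      finally show "T d (z d) powr l \<le> (\<Sum>u\<in>U d. \<gamma> u powr l * dual_sum (\<alpha> * l) (b ^ m) u (v d \<zeta>))" .
    qed
    also have "\<dots> = (\<Sum>u\<in>U d. \<gamma> u powr l * (\<Sum>\<zeta>\<in>Z d. dual_sum (\<alpha> * l) (b ^ m) u (v d \<zeta>)))"
      by (subst sum.swap) (simp only: sum_distrib_left)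
    also have "\<dots> \<le> (\<Sum>u\<in>U d. \<gamma> u powr l *
        (real (card (Z d)) * (2 * real b ^ w d / real (b ^ m)) * (2 * real_zeta (\<alpha> * l)) ^ card u))"
      unfolding Z_def
      by (intro sum_mono mult_left_mono sum_dual_sum_search_space_le[where d = d])
        (use b l finu in \<open>auto simp: U_def v_def\<close>)
    also have "\<dots> = real (card (Z d)) * (2 / real (b ^ m) * B d)"
      unfolding B_def sum_distrib_left by (intro sum.cong refl) (simp add: ac_simps)
    finally show ?thesis using Z(2)[of d] by (metis mult_le_cancel_left_pos of_nat_0_less_iff)
  qed
  have "e2 (\<lambda>j. int b ^ w j * z j) \<le> (\<Sum>d=1..s. T d (z d))"
  proof -
    have MaxU: "u \<in> U (Max u)" if "u \<in> Pow {1..s} - {{}}" for u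
      using that Max_in[of u] finite_subset[of u "{1..s}"] by (auto simp: U_def)
    \<comment> \<open>Charging each set to its maximum counts it exactly once and places it in a
      step where all its coordinates are already final.\<close>
    have "e2 (\<lambda>j. int b ^ w j * z j)
      = (\<Sum>d=1..s. \<Sum>u\<in>{u \<in> Pow {1..s} - {{}}. Max u = d}. \<gamma> u * dual_sum \<alpha> (b ^ m) u (\<lambda>j. int b ^ w j * z j))"
      unfolding e2_def
    proof (rule sum.group[symmetric])
      show "Max ` (Pow {1..s} - {{}}) \<subseteq> {1..s}" using MaxU by (auto simp: U_def)
    qed auto
    also have "\<dots> \<le> (\<Sum>d=1..s. T d (z d))"
    proof (rule sum_mono)
      fix d
      have "(\<Sum>u\<in>{u \<in> Pow {1..s} - {{}}. Max u = d}. \<gamma> u * dual_sum \<alpha> (b ^ m) u (\<lambda>j. int b ^ w j * z j))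
        = (\<Sum>u\<in>{u \<in> Pow {1..s} - {{}}. Max u = d}. \<gamma> u * dual_sum \<alpha> (b ^ m) u (v d (z d)))"
      proof (intro sum.cong refl arg_cong2[of _ _ _ _ "(*)"] dual_sum_cong)
        fix u j assume "u \<in> {u \<in> Pow {1..s} - {{}}. Max u = d}" "j \<in> u"
        then have "j \<le> d" using Max_ge[of u j] finite_subset[of u "{1..s}"] by auto
        then show "int b ^ w j * z j = v d (z d) j" by (auto simp: v_def)
      qed
      \<comment> \<open>Sets that contain \<open>d\<close> and reach beyond it are added here; their
        terms are nonnegative.\<close>
      also have "\<dots> \<le> T d (z d)"
        unfolding T_def
      proof (rule sum_mono2[OF finU])
        show "{u \<in> Pow {1..s} - {{}}. Max u = d} \<subseteq> U d" using MaxU by auto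
      qed (intro mult_nonneg_nonneg dual_sum_nonneg, use \<gamma>U in auto)
      finally show "(\<Sum>u\<in>{u \<in> Pow {1..s} - {{}}. Max u = d}. \<gamma> u * dual_sum \<alpha> (b ^ m) u (\<lambda>j. int b ^ w j * z j)) \<le> T d (z d)" .
    qed
    finally show ?thesis .
  qed
  moreover have "0 \<le> e2 (\<lambda>j. int b ^ w j * z j)"
    unfolding e2_def by (intro sum_nonneg mult_nonneg_nonneg dual_sum_nonneg \<gamma>) auto
  ultimately have "e2 (\<lambda>j. int b ^ w j * z j) powr l \<le> (\<Sum>d=1..s. T d (z d)) powr l"
    using l by (intro powr_mono2) auto
  also have "\<dots> \<le> (\<Sum>d=1..s. T d (z d) powr l)"
    using l T_nonneg by (intro sum_powr_le_sum_of_powr) auto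
  also have "\<dots> \<le> (\<Sum>d=1..s. 2 / real (b ^ m) * B d)" by (intro sum_mono T_bound)
  finally show ?thesis by (simp only: B_def U_def flip: sum_distrib_left)
qed

theorem corollary2:
  fixes b m s N :: nat
    and \<alpha> :: real
    and \<gamma> :: "nat set \<Rightarrow> real"
    and w :: "nat \<Rightarrow> nat"
    and H :: "((nat \<Rightarrow> real) \<Rightarrow> complex) set"
    and ip :: "((nat \<Rightarrow> real) \<Rightarrow> complex) \<Rightarrow> ((nat \<Rightarrow> real) \<Rightarrow> complex) \<Rightarrow> complex"
    and z0 z :: "nat \<Rightarrow> int"
  assumes "prime b" and "1 \<le> m" and "N = b ^ m" and "1 \<le> s" and "1 < \<alpha>"
    and "\<And>u. finite u \<Longrightarrow> u \<subseteq> {1..} \<Longrightarrow> 0 < \<gamma> u"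
    and "\<gamma> {} = 1"
    and "mono_on {1..} w"
    and "rkhs (unit_cube s) (korobov_kernel s \<alpha> \<gamma>) H ip"
    and "\<And>j. j \<in> {1..s} \<Longrightarrow> z0 j \<in> {0..int N - 1}"
    and "reduced_scs (\<lambda>\<xi>. (worst_case_error H ip N s \<xi>)\<^sup>2) b m s w z0 z"
  defines "err \<equiv> worst_case_error H ip N s (\<lambda>j. int b ^ w j * z j)"
  shows "(\<forall>\<delta>\<in>{0<..(\<alpha> - 1) / 2}.
            err \<le> const_C b w s \<alpha> \<gamma> \<delta> * real N powr (- \<alpha> / 2 + \<delta>))
       \<and> (\<forall>\<delta>\<in>{0<..(\<alpha> - 1) / 2}. \<forall>q\<ge>0. const_C_sup b w \<alpha> \<gamma> \<delta> q < \<infinity> \<longrightarrow>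
            err \<le> (real s powr q * real_of_ereal (const_C_sup b w \<alpha> \<gamma> \<delta> q)) powr (\<alpha> / 2 - \<delta>)
                    * real N powr (- \<alpha> / 2 + \<delta>))
       \<and> (\<forall>\<delta>\<in>{0<..(\<alpha> - 1) / 2}. const_C_sup b w \<alpha> \<gamma> \<delta> 0 < \<infinity> \<longrightarrow>
            err \<le> (real_of_ereal (const_C_sup b w \<alpha> \<gamma> \<delta> 0)) powr (\<alpha> / 2 - \<delta>)
                    * real N powr (- \<alpha> / 2 + \<delta>))"
proof -
  have \<gamma>: "0 \<le> \<gamma> u" if "u \<subseteq> {1..s}" for u
  proof -
    have "finite u" "u \<subseteq> {1..}" using that finite_subset by auto
    then show ?thesis using assms(6) by (simp add: less_imp_le)
  qed
  interpret korobov_rkhs s \<alpha> \<gamma> H ip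
    by (intro korobov_rkhs.intro korobov_rkhs_axioms.intro assms(5,9) \<gamma>)
  have N: "0 < N" using assms(1,3) prime_gt_0_nat by simp
  define e2 where "e2 = (\<lambda>\<xi>. \<Sum>u\<in>Pow {1..s} - {{}}. \<gamma> u * dual_sum \<alpha> (b ^ m) u \<xi>)"
  have e2: "worst_case_error H ip N s \<xi> = sqrt (e2 \<xi>)" "0 \<le> e2 \<xi>" for \<xi>
    using worst_case_error_eq[OF N, of \<xi>] dual_error_nonneg[of N \<xi>]
    by (simp_all add: e2_def dual_error_def assms(3))
  \<comment> \<open>The squared worst-case error and \<open>e2\<close> agree at every integer
    vector, so both objectives define the same search.\<close>
  then have scs: "reduced_scs e2 b m s w z0 z" using assms(11) by simp
  define W where "W = weight_sum b w \<alpha> \<gamma>"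
  have W_nonneg: "0 \<le> W \<delta> n" if "\<delta> \<in> {0<..(\<alpha> - 1) / 2}" for \<delta> n
  proof -
    have "1 < \<alpha> / (\<alpha> - 2 * \<delta>)" using that by (simp add: field_simps)
    then show ?thesis
      unfolding W_def weight_sum_def using real_zeta_pos[of "\<alpha> / (\<alpha> - 2 * \<delta>)"]
      by (intro sum_nonneg mult_nonneg_nonneg zero_le_power) auto
  qed
  have main: "err \<le> (2 * W \<delta> s) powr (\<alpha> / 2 - \<delta>) * real N powr (- \<alpha> / 2 + \<delta>)"
    if \<delta>: "\<delta> \<in> {0<..(\<alpha> - 1) / 2}" for \<delta>
  proof -
    \<comment> \<open>Here l \<le> 1 amounts to \<delta> \<le> (\<alpha> - 1) / 2 and \<alpha> * l >
      1 to \<delta> > 0. Since 1 / (2 * l) = \<alpha> / 2 - \<delta>, raising to this power undoes l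
      and takes the square root of e^2 at once.\<close>
    define l where "l = 1 / (\<alpha> - 2 * \<delta>)"
    have l: "0 < l" "l \<le> 1" "1 < \<alpha> * l" and al: "\<alpha> * l = \<alpha> / (\<alpha> - 2 * \<delta>)"
      and le: "1 / l * (1 / 2) = \<alpha> / 2 - \<delta>"
      using \<delta> by (auto simp: l_def field_simps)
    define x where "x = (\<lambda>j. int b ^ w j * z j)"
    have "e2 x powr l \<le> 2 / real N * W \<delta> s"
      unfolding e2_def x_def W_def weight_sum_def assms(3) al[symmetric] l_def[symmetric]
      by (rule reduced_scs_dual_error_bound[OF assms(1) _ l(1,2) assms(5) l(3) scs[unfolded e2_def]]) (rule \<gamma>)
    then have "(e2 x powr l) powr (\<alpha> / 2 - \<delta>) \<le> (2 / real N * W \<delta> s) powr (\<alpha> / 2 - \<delta>)"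
      using \<delta> by (intro powr_mono2) (auto simp: field_simps)
    also have "(e2 x powr l) powr (\<alpha> / 2 - \<delta>) = e2 x powr (1 / 2)"
      unfolding le[symmetric] powr_powr using l by simp
    also have "\<dots> = err" unfolding err_def e2(1) x_def[symmetric] using e2(2) by (simp add: powr_half_sqrt)
    also have "(2 / real N * W \<delta> s) powr (\<alpha> / 2 - \<delta>) = (2 * W \<delta> s / real N) powr (\<alpha> / 2 - \<delta>)" by simp
    also have "\<dots> = (2 * W \<delta> s) powr (\<alpha> / 2 - \<delta>) / real N powr (\<alpha> / 2 - \<delta>)"
      using W_nonneg[OF \<delta>] by (simp add: powr_divide)
    also have "\<dots> = (2 * W \<delta> s) powr (\<alpha> / 2 - \<delta>) * real N powr (- (\<alpha> / 2 - \<delta>))"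
      by (simp only: powr_minus divide_inverse)
    also have "- (\<alpha> / 2 - \<delta>) = - \<alpha> / 2 + \<delta>" by simp
    finally show ?thesis .
  qed
  have sup: "err \<le> (real s powr q * real_of_ereal (const_C_sup b w \<alpha> \<gamma> \<delta> q)) powr (\<alpha> / 2 - \<delta>)
                    * real N powr (- \<alpha> / 2 + \<delta>)"
    if \<delta>: "\<delta> \<in> {0<..(\<alpha> - 1) / 2}" and fin: "const_C_sup b w \<alpha> \<gamma> \<delta> q < \<infinity>" for \<delta> q
  proof -
    have up: "ereal (2 / real s powr q * W \<delta> s) \<le> const_C_sup b w \<alpha> \<gamma> \<delta> q"
      unfolding const_C_sup_def W_def using assms(4) by (intro SUP_upper) auto
    \<comment> \<open>The supremum is bounded below by a real term and is not \<infinity>, hence it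
      is a real number.\<close>
    then obtain c where c: "const_C_sup b w \<alpha> \<gamma> \<delta> q = ereal c"
      using fin by (cases "const_C_sup b w \<alpha> \<gamma> \<delta> q") auto
    have "2 * W \<delta> s \<le> real s powr q * c"
      using up assms(4) unfolding c by (simp add: divide_simps mult.commute split: if_splits)
    then have "(2 * W \<delta> s) powr (\<alpha> / 2 - \<delta>) \<le> (real s powr q * c) powr (\<alpha> / 2 - \<delta>)"
      using W_nonneg[OF \<delta>] \<delta> by (intro powr_mono2) (auto simp: field_simps)
    then show ?thesis using main[OF \<delta>] unfolding c
      by (simp add: order_trans[OF _ mult_right_mono])
  qed
  show ?thesis
    \<comment> \<open>For q = 0 the factor \<open>real s powr 0\<close> is 1 because s \<ge>
      1.\<close>
    using main sup sup[of _ 0] assms(4) by (simp add: const_C_def W_def)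
qed

end
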